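(* Let $\Sigma$ be a simplicial fan in $\mathbb{R}^d$ with $n$ rays and ray matrix $U\in\mathbb{R}^{n\times d}$, and let $\tau\in\Sigma(k)$. The restriction of ${\rm Adj}_{\Sigma,U}(x)$ to the $(n-k-1)$-dimensional subspace $\Lambda_\tau$ equals $$({\rm Adj}_{\Sigma,U})_{|\Lambda_\tau}=c_\tau^{-1}\cdot\Big(\prod_{\rho\notin{\rm nb}(\tau),\ \rho\notin\tau(1)}x_\rho\Big)\cdot{\rm Adj}_{\Sigma_\tau,U_\tau}.$$
   Context: A simplicial fan $\Sigma$ is a (finite) polyhedral fan whose cones are generated by linearly independent vectors. $\Sigma(k)$ is the set of $k$-dimensional cones, $\sigma(1)$ the set of rays of $\sigma$, $n=|\Sigma(1)|$. A ray matrix $U\in\mathbb{R}^{n\times d}$, assumed of rank $d$, has rows $u_\rho$, $\rho\in\Sigma(1)$, with $u_\rho$ a nonzero generator of $\rho$; for $\sigma\in\Sigma(d)$, $U_\sigma$ is the submatrix with rows indexed by $\sigma(1)$. The universal adjoint is ${\rm Adj}_{\Sigma,U}(x)=\sum_{\sigma\in\Sigma(d)}|\det U_\sigma|\prod_{\rho\notin\sigma(1)}x_\rho\in\mathbb{C}[x_\rho:\rho\in\Sigma(1)]$. $\Lambda_\tau=\{x\in\mathbb{P}^{n-1}:x_\rho=0\text{ for all }\rho\in\tau(1)\}$, where $\mathbb{P}^{n-1}$ is complex projective space with homogeneous coordinates $x_\rho$; restriction to $\Lambda_\tau$ means setting $x_\rho=0$ for $\rho\in\tau(1)$. ${\rm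 nb}(\tau)=\{\rho\in\Sigma(1):\tau(1)\cup\{\rho\}=\sigma(1)\text{ for some }\sigma\in\Sigma(k+1)\}$. The star fan is $\Sigma_\tau=\{\overline\sigma\subseteq\mathbb{R}^d/{\rm span}_{\mathbb{R}}(\tau):\tau\text{ is a face of }\sigma\in\Sigma\}$, where $\overline\sigma$ is the image of $\sigma$; its rays are $\overline\rho$, $\rho\in{\rm nb}(\tau)$ (a bijection), and one identifies $x_{\overline\rho}=x_\rho$. Choose an invertible $d\times d$ matrix $T_\tau$ such that the rows of $U\cdot T_\tau$ labeled by $\tau(1)$ are the standard basis vectors $e_1,\dots,e_k$, and set $c_\tau=|\det T_\tau|$. $U_\tau$ is the submatrix of $U\cdot T_\tau$ consisting of the last $d-k$ columns and the rows indexed by ${\rm nb}(\tau)$; its rows generate the rays of $\Sigma_\tau$, viewed in $\mathbb{R}^{d-k}$ via the coordinates given by $T_\tau$. ${\rm Adj}_{\Sigma_\tau,U_\tau}=\sum_{\overline\sigma\in\Sigma_\tau(d-k)}|\det(U_\tau)_{\overline\sigma}|\prod_{\overline\rho\notin\overline\sigma(1)}x_\rho$ in the variables $x_\rho$, $\rho\in{\rm nb}(\tau)$ (it is $0$ if $\Sigma_\tau$ has no $(d-k)$-dimensional cones; the empty determinant is $1$). *)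

theory Defs
  imports
    "Jordan_Normal_Form.DL_Rank"
    "Jordan_Normal_Form.DL_Submatrix"
    "HOL-Library.Poly_Mapping"
begin

section \<open>Linear algebra in coordinate spaces\<close>

abbreviation vspan :: "nat \<Rightarrow> 'a::field vec set \<Rightarrow> 'a vec set" where
  "vspan d S \<equiv> LinearCombinations.module.span class_ring (module_vec TYPE('a) d) S"

abbreviation vlin_indpt :: "nat \<Rightarrow> 'a::field vec set \<Rightarrow> bool" where
  "vlin_indpt d S \<equiv> LinearCombinations.module.lin_indpt class_ring (module_vec TYPE('a) d) S"

definition lin_dim :: "nat \<Rightarrow> 'a::field vec set \<Rightarrow> nat" where
  "lin_dim d S = vectorspace.dim class_ring (module_vec TYPE('a) d \<lparr>carrier := vspan d S\<rparr>)"

section \<open>Cones and fans\<close>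

definition cone_gen :: "nat \<Rightarrow> real vec set \<Rightarrow> real vec set" where
  "cone_gen d S = {finsum_vec TYPE(real) d (\<lambda>v. c v \<cdot>\<^sub>v v) S | c. \<forall>v\<in>S. 0 \<le> c v}"

definition polyhedral_cone :: "nat \<Rightarrow> real vec set \<Rightarrow> bool" where
  "polyhedral_cone d \<sigma> \<longleftrightarrow> (\<exists>S. finite S \<and> S \<subseteq> carrier_vec d \<and> \<sigma> = cone_gen d S)"

definition simplicial_cone :: "nat \<Rightarrow> real vec set \<Rightarrow> bool" where
  "simplicial_cone d \<sigma> \<longleftrightarrow>
     (\<exists>S. finite S \<and> S \<subseteq> carrier_vec d \<and> vlin_indpt d S \<and> \<sigma> = cone_gen d S)"

text \<open>The choice \<open>u = 0\<close> makes \<open>\<sigma>\<close> a face of itself; the empty set is not a face of a cone.\<close>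

definition cone_face :: "nat \<Rightarrow> real vec set \<Rightarrow> real vec set \<Rightarrow> bool" where
  "cone_face d \<tau> \<sigma> \<longleftrightarrow>
     (\<exists>u\<in>carrier_vec d. (\<forall>x\<in>\<sigma>. 0 \<le> u \<bullet> x) \<and> \<tau> = {x\<in>\<sigma>. u \<bullet> x = 0})"

definition polyhedral_fan :: "nat \<Rightarrow> real vec set set \<Rightarrow> bool" where
  "polyhedral_fan d \<Sigma> \<longleftrightarrow>
     finite \<Sigma> \<and>
     (\<forall>\<sigma>\<in>\<Sigma>. polyhedral_cone d \<sigma>) \<and>
     (\<forall>\<sigma>\<in>\<Sigma>. \<forall>\<tau>. cone_face d \<tau> \<sigma> \<longrightarrow> \<tau> \<in> \<Sigma>) \<and>
     (\<forall>\<sigma>\<in>\<Sigma>. \<forall>\<sigma>'\<in>\<Sigma>. cone_face d (\<sigma> \<inter> \<sigma>') \<sigma> \<and> cone_face d (\<sigma> \<inter> \<sigma>') \<sigma>')"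

definition simplicial_fan :: "nat \<Rightarrow> real vec set set \<Rightarrow> bool" where
  "simplicial_fan d \<Sigma> \<longleftrightarrow> polyhedral_fan d \<Sigma> \<and> (\<forall>\<sigma>\<in>\<Sigma>. simplicial_cone d \<sigma>)"

text \<open>\<open>cones d \<Sigma> k\<close> is \<open>\<Sigma>(k)\<close>, and \<open>rays d \<sigma>\<close> is \<open>\<sigma>(1)\<close>.\<close>

definition cones :: "nat \<Rightarrow> real vec set set \<Rightarrow> nat \<Rightarrow> real vec set set" where
  "cones d \<Sigma> k = {\<sigma>\<in>\<Sigma>. lin_dim d \<sigma> = k}"

definition rays :: "nat \<Rightarrow> real vec set \<Rightarrow> real vec set set" where
  "rays d \<sigma> = {\<rho>. cone_face d \<rho> \<sigma> \<and> lin_dim d \<rho> = 1}"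

definition nb :: "nat \<Rightarrow> real vec set set \<Rightarrow> real vec set \<Rightarrow> real vec set set" where
  "nb d \<Sigma> \<tau> =
     {\<rho>\<in>cones d \<Sigma> 1. \<exists>\<sigma>\<in>cones d \<Sigma> (lin_dim d \<tau> + 1). rays d \<tau> \<union> {\<rho>} = rays d \<sigma>}"

section \<open>Ray matrices\<close>

text \<open>The rows of a ray matrix are labeled by rays: the list \<open>rs\<close> enumerates the rays of the fan
  without repetition, and row \<open>i\<close> of \<open>U\<close> is the row with label \<open>rs ! i\<close>.\<close>

definition ray_matrix :: "nat \<Rightarrow> real vec set set \<Rightarrow> real vec set list \<Rightarrow> real mat \<Rightarrow> bool" where
  "ray_matrix d \<Sigma> rs U \<longleftrightarrow>
     distinct rs \<and> set rs = cones d \<Sigma> 1 \<and>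
     U \<in> carrier_mat (length rs) d \<and>
     (\<forall>i<length rs. row U i \<noteq> 0\<^sub>v d \<and> rs ! i = cone_gen d {row U i}) \<and>
     vec_space.rank (length rs) U = d"

definition row_ids :: "'r list \<Rightarrow> 'r set \<Rightarrow> nat set" where
  "row_ids rs R = {i. i < length rs \<and> rs ! i \<in> R}"

section \<open>Polynomials with complex coefficients\<close>

text \<open>Exponent vectors are finitely supported maps from variables to naturals, and polynomials are
  finitely supported maps from exponent vectors to coefficients; \<open>(*)\<close> is convolution.\<close>

type_synonym 'v cpoly = "('v \<Rightarrow>\<^sub>0 nat) \<Rightarrow>\<^sub>0 complex"

definition pconst :: "complex \<Rightarrow> 'v cpoly" where
  "pconst c = Poly_Mapping.single 0 c"

definition pvar :: "'v \<Rightarrow> 'v cpoly" where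
  "pvar v = Poly_Mapping.single (Poly_Mapping.single v 1) 1"

definition psubst :: "('v \<Rightarrow> 'w cpoly) \<Rightarrow> 'v cpoly \<Rightarrow> 'w cpoly" where
  "psubst s p = (\<Sum>m\<in>Poly_Mapping.keys p.
     pconst (Poly_Mapping.lookup p m) * (\<Prod>v\<in>Poly_Mapping.keys m. s v ^ Poly_Mapping.lookup m v))"

definition prename :: "('v \<Rightarrow> 'w) \<Rightarrow> 'v cpoly \<Rightarrow> 'w cpoly" where
  "prename f = psubst (\<lambda>v. pvar (f v))"

definition set_to_zero :: "'v set \<Rightarrow> 'v cpoly \<Rightarrow> 'v cpoly" where
  "set_to_zero R = psubst (\<lambda>v. if v \<in> R then 0 else pvar v)"

section \<open>The universal adjoint\<close>

definition Adj :: "nat \<Rightarrow> real vec set set \<Rightarrow> real vec set list \<Rightarrow> real mat \<Rightarrow> real vec set cpoly" where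
  "Adj d \<Sigma> rs U =
     (\<Sum>\<sigma>\<in>cones d \<Sigma> d.
        pconst (complex_of_real \<bar>det (submatrix U (row_ids rs (rays d \<sigma>)) UNIV)\<bar>) *
        (\<Prod>\<rho>\<in>cones d \<Sigma> 1 - rays d \<sigma>. pvar \<rho>))"

section \<open>Coordinate subspaces of projective space\<close>

definition proj_point :: "complex vec \<Rightarrow> complex vec set" where
  "proj_point x = {c \<cdot>\<^sub>v x | c. c \<noteq> 0}"

text \<open>Here \<open>m\<close> is the projective dimension, one less than the dimension of the underlying linear
  subspace; the empty set is the linear subspace of dimension \<open>-1\<close>.\<close>

definition proj_lin_subspace :: "nat \<Rightarrow> int \<Rightarrow> complex vec set set \<Rightarrow> bool" where
  "proj_lin_subspace n m L \<longleftrightarrow>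
     (\<exists>W. VectorSpace.subspace class_ring W (module_vec TYPE(complex) n) \<and>
          L = proj_point ` (W - {0\<^sub>v n}) \<and> int (lin_dim n W) - 1 = m)"

text \<open>\<open>\<Lambda>\<^sub>\<tau>\<close>, where the homogeneous coordinate with index \<open>i\<close> is \<open>x\<^sub>\<rho>\<close> for \<open>\<rho> = rs ! i\<close>.\<close>

definition Lambda :: "nat \<Rightarrow> real vec set list \<Rightarrow> real vec set \<Rightarrow> complex vec set set" where
  "Lambda d rs \<tau> = proj_point `
     {x\<in>carrier_vec (length rs). x \<noteq> 0\<^sub>v (length rs) \<and>
        (\<forall>i<length rs. rs ! i \<in> rays d \<tau> \<longrightarrow> x $ i = 0)}"

definition restrict_Lambda ::
  "nat \<Rightarrow> real vec set \<Rightarrow> real vec set cpoly \<Rightarrow> real vec set cpoly" where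
  "restrict_Lambda d \<tau> = set_to_zero (rays d \<tau>)"

section \<open>Star fans\<close>

text \<open>The elements of the quotient of \<open>\<real>\<^sup>d\<close> by the span of \<open>\<tau>\<close> are cosets, so a cone in the quotient
  is a set of cosets.\<close>

definition coset_mod :: "nat \<Rightarrow> real vec set \<Rightarrow> real vec \<Rightarrow> real vec set" where
  "coset_mod d \<tau> x = {x + w | w. w \<in> vspan d \<tau>}"

definition star_fan :: "nat \<Rightarrow> real vec set set \<Rightarrow> real vec set \<Rightarrow> real vec set set set" where
  "star_fan d \<Sigma> \<tau> = {coset_mod d \<tau> ` \<sigma> | \<sigma>. \<sigma> \<in> \<Sigma> \<and> cone_face d \<tau> \<sigma>}"

definition adapted_matrix ::
  "nat \<Rightarrow> real vec set list \<Rightarrow> real mat \<Rightarrow> real vec set \<Rightarrow> real mat \<Rightarrow> bool" where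
  "adapted_matrix d rs U \<tau> T \<longleftrightarrow>
     T \<in> carrier_mat d d \<and> invertible_mat T \<and>
     {row (U * T) i | i. i \<in> row_ids rs (rays d \<tau>)} = {unit_vec d j | j. j < lin_dim d \<tau>}"

text \<open>For an adapted \<open>T\<close>, the coordinates of \<open>x\<close> are the entries of the row vector \<open>x T\<close>. Those of
  the elements of the span of \<open>\<tau>\<close> vanish beyond the first \<open>dim \<tau>\<close>, so the remaining coordinates
  are constant on cosets and identify the quotient with \<open>\<real>\<^sup>(\<^sup>d\<^sup>-\<^sup>k\<^sup>)\<close>.\<close>

definition quot_coords :: "nat \<Rightarrow> real vec set \<Rightarrow> real mat \<Rightarrow> real vec set \<Rightarrow> real vec" where
  "quot_coords d \<tau> T C =
     (THE y. \<forall>x\<in>C. y = vec_last (transpose_mat T *\<^sub>v x) (d - lin_dim d \<tau>))"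

definition bar_cone :: "nat \<Rightarrow> real vec set \<Rightarrow> real mat \<Rightarrow> real vec set \<Rightarrow> real vec set" where
  "bar_cone d \<tau> T \<sigma> = quot_coords d \<tau> T ` (coset_mod d \<tau> ` \<sigma>)"

definition star_fan_coords ::
  "nat \<Rightarrow> real vec set set \<Rightarrow> real vec set \<Rightarrow> real mat \<Rightarrow> real vec set set" where
  "star_fan_coords d \<Sigma> \<tau> T = (\<lambda>K. quot_coords d \<tau> T ` K) ` star_fan d \<Sigma> \<tau>"

definition star_matrix ::
  "nat \<Rightarrow> real vec set set \<Rightarrow> real vec set list \<Rightarrow> real mat \<Rightarrow> real vec set \<Rightarrow> real mat \<Rightarrow> real mat" where
  "star_matrix d \<Sigma> rs U \<tau> T =
     submatrix (U * T) (row_ids rs (nb d \<Sigma> \<tau>)) {lin_dim d \<tau>..<d}"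

definition star_rays ::
  "nat \<Rightarrow> real vec set set \<Rightarrow> real vec set list \<Rightarrow> real vec set \<Rightarrow> real mat \<Rightarrow> real vec set list" where
  "star_rays d \<Sigma> rs \<tau> T = map (bar_cone d \<tau> T) (filter (\<lambda>\<rho>. \<rho> \<in> nb d \<Sigma> \<tau>) rs)"

text \<open>The adjoint of the star fan is a polynomial in variables indexed by the image rays; the
  renaming replaces each of these by the ray in \<open>nb(\<tau>)\<close> it comes from.\<close>

definition Adj_star ::
  "nat \<Rightarrow> real vec set set \<Rightarrow> real vec set list \<Rightarrow> real mat \<Rightarrow> real vec set \<Rightarrow> real mat
    \<Rightarrow> real vec set cpoly" where
  "Adj_star d \<Sigma> rs U \<tau> T =
     prename (inv_into (nb d \<Sigma> \<tau>) (bar_cone d \<tau> T))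
       (Adj (d - lin_dim d \<tau>) (star_fan_coords d \<Sigma> \<tau> T)
         (star_rays d \<Sigma> rs \<tau> T) (star_matrix d \<Sigma> rs U \<tau> T))"

end

theory Submission
  imports Defs
begin

text \<open>Setting \<open>x\<^sub>\<rho> = 0\<close> for the rays of \<open>\<tau>\<close> kills every term of the adjoint except those of the maximal
  cones \<open>\<sigma>\<close> that contain \<open>\<tau>\<close>, and for these all rays outside \<open>\<tau>(1) \<union> nb(\<tau>)\<close> contribute a common factor.
  In the coordinates given by \<open>T\<close> the rows of \<open>U\<^sub>\<sigma> T\<close> that belong to \<open>\<tau>\<close> are unit vectors, so up to the
  order of its rows \<open>U\<^sub>\<sigma> T\<close> is block triangular with diagonal blocks the identity and the matrix of the
  image of \<open>\<sigma>\<close> in the star fan. Hence the two determinants differ by the factor \<open>det T\<close>.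

  The combinatorics of the star fan rests on writing each cone \<open>\<sigma>\<close> as the nonnegative combinations of
  the linearly independent rows of \<open>U\<close> labelled by \<open>\<sigma>(1)\<close>: faces are then subsets of \<open>\<sigma>(1)\<close>, and modulo
  the span of \<open>\<tau>\<close> the rows labelled by \<open>\<sigma>(1) - \<tau>(1)\<close> stay independent.\<close>

section \<open>Substitution in sums of squarefree monomials\<close>

text \<open>Summing over a common superset of the keys lets substitutions into two polynomials be
  added term by term; the extra monomials have coefficient 0.\<close>

lemma psubst_superset:
  assumes "finite M" "Poly_Mapping.keys p \<subseteq> M"
  shows "psubst s p = (\<Sum>m\<in>M. pconst (Poly_Mapping.lookup p m) *
    (\<Prod>v\<in>Poly_Mapping.keys m. s v ^ Poly_Mapping.lookup m v))"
  unfolding psubst_def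
  by (rule sum.mono_neutral_left[OF assms]) (auto simp: pconst_def in_keys_iff)

lemma psubst_zero: "psubst s 0 = 0"
  by (simp add: psubst_def)

lemma psubst_add: "psubst s (p + q) = psubst s p + psubst s q"
proof -
  let ?M = "Poly_Mapping.keys p \<union> Poly_Mapping.keys q"
  have "Poly_Mapping.keys (p + q) \<subseteq> ?M" by (rule Poly_Mapping.keys_add)
  then show ?thesis
    by (simp add: psubst_superset[where M = ?M] lookup_add pconst_def single_add
        distrib_right sum.distrib)
qed

lemma psubst_sum: "psubst s (sum p A) = (\<Sum>a\<in>A. psubst s (p a))"
  by (induction A rule: infinite_finite_induct) (auto simp: psubst_zero psubst_add)

lemma prod_pvar:
  assumes "finite B"
  shows "(\<Prod>v\<in>B. pvar v) = Poly_Mapping.single (\<Sum>v\<in>B. Poly_Mapping.single v 1) 1"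
  using assms
  by (induction B) (auto simp: pvar_def mult_single simp flip: single_one)

lemma lookup_sum_single:
  assumes "finite B"
  shows "Poly_Mapping.lookup (\<Sum>v\<in>B. Poly_Mapping.single v (1::nat)) x = (if x \<in> B then 1 else 0)"
  using assms by (induction B) (auto simp: lookup_add lookup_single when_def)

text \<open>All terms of an adjoint have this shape, so together with \<open>psubst_sum\<close> it
  evaluates both the restriction and the renaming. The exponents are all 1, so the powers in
  \<open>psubst\<close> disappear.\<close>

lemma psubst_squarefree_monomial:
  assumes "finite B"
  shows "psubst s (pconst c * (\<Prod>v\<in>B. pvar v)) = pconst c * (\<Prod>v\<in>B. s v)"
proof -
  let ?m = "\<Sum>v\<in>B. Poly_Mapping.single v (1::nat)"
  have k: "Poly_Mapping.keys ?m = B"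
    using lookup_sum_single[OF assms] by (auto simp: in_keys_iff split: if_splits)
  have "pconst c * (\<Prod>v\<in>B. pvar v) = Poly_Mapping.single ?m c"
    by (simp add: prod_pvar[OF assms] pconst_def mult_single)
  then have "psubst s (pconst c * (\<Prod>v\<in>B. pvar v)) =
      pconst c * (\<Prod>v\<in>B. s v ^ Poly_Mapping.lookup ?m v)"
    using psubst_superset[of "{?m}" "Poly_Mapping.single ?m c" s] by (simp only: k) (simp add: k[unfolded One_nat_def])
  also have "(\<Prod>v\<in>B. s v ^ Poly_Mapping.lookup ?m v) = (\<Prod>v\<in>B. s v)"
    by (rule prod.cong) (auto simp: lookup_sum_single[OF assms, unfolded One_nat_def])
  finally show ?thesis .
qed

lemma pconst_mult: "pconst (a * b) = pconst a * pconst b"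
  by (simp add: pconst_def mult_single)

section \<open>Determinants of row selections\<close>

text \<open>\<open>pick I\<close> is strictly increasing on these indices, hence injective, and
  comparing cardinalities gives surjectivity.\<close>

lemma pick_bij_betw:
  assumes "finite I"
  shows "bij_betw (pick I) {..<card I} I"
proof -
  have "inj_on (pick I) {..<card I}"
    by (rule inj_onI) (metis assms lessThan_iff linorder_neqE_nat nat_less_le pick_mono_le)
  moreover have "pick I ` {..<card I} \<subseteq> I"
    using pick_in_set_le by auto
  ultimately show ?thesis
    by (metis assms bij_betw_def card_image card_lessThan card_subset_eq)
qed

lemma pick_atLeastLessThan:
  assumes "j < d - k"
  shows "pick {k..<d} j = k + j"
proof -
  have "{a \<in> {k..<d}. a < k + j} = {k..<k + j}" using assms by auto
  then have "card {a \<in> {k..<d}. a < k + j} = j" by simp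
  with pick_card_in_set[of "k + j" "{k..<d}"] assms show ?thesis by simp
qed

lemma submatrix_UNIV_cols:
  assumes "I \<subseteq> {..<dim_row A}"
  shows "submatrix A I UNIV = mat (card I) (dim_col A) (\<lambda>(i, j). A $$ (pick I i, j))"
proof -
  have "{i. i < dim_row A \<and> i \<in> I} = I" using assms by auto
  then show ?thesis by (auto simp: submatrix_def pick_UNIV)
qed

text \<open>Two enumerations of the same labels differ by a permutation, which affects the
  determinant only by its sign. This makes the order of the rows irrelevant later on.\<close>

lemma abs_det_row_reindex:
  fixes R :: "'i \<Rightarrow> nat \<Rightarrow> real"
  assumes f: "bij_betw f {..<m} I" and g: "bij_betw g {..<m} I"
  shows "\<bar>det (mat m m (\<lambda>(i, j). R (f i) j))\<bar> = \<bar>det (mat m m (\<lambda>(i, j). R (g i) j))\<bar>"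
proof -
  let ?A = "mat m m (\<lambda>(i, j). R (g i) j)"
  \<comment> \<open>\<open>permutes\<close> demands the identity outside \<open>{0..<m}\<close>,
    hence the default value \<open>i\<close>.\<close>
  define p where "p i = (if i < m then inv_into {..<m} g (f i) else i)" for i
  have "bij_betw (inv_into {..<m} g \<circ> f) {..<m} {..<m}"
    using f g by (meson bij_betw_inv_into bij_betw_trans)
  then have "bij_betw p {..<m} {..<m}"
    by (rule bij_betw_cong[THEN iffD1, rotated]) (simp add: p_def)
  then have p: "p permutes {0..<m}"
    by (intro bij_imp_permutes) (auto simp: p_def atLeast0LessThan)
  have gp: "g (p i) = f i" "p i < m" if "i < m" for i
    using that f g p permutes_in_image[OF p, of i]
    by (auto simp: p_def bij_betw_def f_inv_into_f)
  have "mat m m (\<lambda>(i, j). R (f i) j) = mat m m (\<lambda>(i, j). ?A $$ (p i, j))"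
    by (rule eq_matI) (auto simp: gp)
  then have "det (mat m m (\<lambda>(i, j). R (f i) j)) = signof p * det ?A"
    using det_permute_rows[OF _ p, of ?A] by simp
  then show ?thesis by (simp add: abs_mult sign_def)
qed

text \<open>Listing the rows labelled by \<open>J\<close> first makes the matrix block triangular,
  with the identity in the upper left corner and zero in the upper right one.\<close>

lemma abs_det_unit_rows:
  fixes R :: "'i \<Rightarrow> nat \<Rightarrow> real"
  assumes f: "bij_betw f {..<k + m} I" and p: "bij_betw p {..<k} J" and "J \<subseteq> I"
    and g: "bij_betw g {..<m} (I - J)"
    and unit: "\<And>i j. i < k \<Longrightarrow> j < k + m \<Longrightarrow> R (p i) j = (if i = j then 1 else 0)"
  shows "\<bar>det (mat (k + m) (k + m) (\<lambda>(i, j). R (f i) j))\<bar> =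
    \<bar>det (mat m m (\<lambda>(i, j). R (g i) (k + j)))\<bar>"
proof -
  define h where "h i = (if i < k then p i else g (i - k))" for i
  have "bij_betw (\<lambda>i. g (i - k)) {k..<k + m} (I - J)"
  proof -
    have "bij_betw (\<lambda>i. i - k) {k..<k + m} {..<m}"
      by (rule bij_betw_byWitness[where f' = "\<lambda>i. i + k"]) auto
    from bij_betw_trans[OF this g] show ?thesis by (simp add: o_def)
  qed
  then have "bij_betw h ({..<k} \<union> {k..<k + m}) (J \<union> (I - J))"
    using p unfolding h_def
    by (intro bij_betw_combine) (auto elim!: bij_betw_cong[THEN iffD1, rotated])
  moreover have "{..<k} \<union> {k..<k + m} = {..<k + m}" by auto
  ultimately have h: "bij_betw h {..<k + m} I" using \<open>J \<subseteq> I\<close> by (simp add: Un_absorb1)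
  have "mat (k + m) (k + m) (\<lambda>(i, j). R (h i) j) =
      four_block_mat (1\<^sub>m k) (0\<^sub>m k m) (mat m k (\<lambda>(i, j). R (g i) j))
        (mat m m (\<lambda>(i, j). R (g i) (k + j)))"
    by (rule eq_matI) (auto simp: h_def unit four_block_mat_def Let_def)
  then have "det (mat (k + m) (k + m) (\<lambda>(i, j). R (h i) j)) =
      det (mat m m (\<lambda>(i, j). R (g i) (k + j)))"
    by (simp add: det_four_block_mat_upper_right_zero[where n = k and m = m])
  with abs_det_row_reindex[OF f h, of R] show ?thesis by simp
qed

section \<open>Linear combinations of labelled vectors\<close>

text \<open>Coefficients sit on labels rather than on vectors, so they can be kept when the family
  \<open>u\<close> is replaced by its image under a linear map.\<close>

definition vcomb :: "nat \<Rightarrow> ('i \<Rightarrow> 'a::field vec) \<Rightarrow> ('i \<Rightarrow> 'a) \<Rightarrow> 'i set \<Rightarrow> 'a vec" where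
  "vcomb m u c I = vec m (\<lambda>j. \<Sum>i\<in>I. c i * u i $ j)"

text \<open>For finite \<open>I\<close> a repeated vector already counts as a dependence, unlike in
  the notion for sets of vectors.\<close>

definition indep_family :: "nat \<Rightarrow> ('i \<Rightarrow> 'a::field vec) \<Rightarrow> 'i set \<Rightarrow> bool" where
  "indep_family m u I \<longleftrightarrow> (\<forall>c. vcomb m u c I = 0\<^sub>v m \<longrightarrow> (\<forall>i\<in>I. c i = 0))"

lemma vcomb_carrier [simp]: "vcomb m u c I \<in> carrier_vec m"
  by (simp add: vcomb_def)

lemma dim_vcomb [simp]: "dim_vec (vcomb m u c I) = m"
  by (simp add: vcomb_def)

lemma vcomb_cong:
  "(\<And>i. i \<in> I \<Longrightarrow> c i = c' i) \<Longrightarrow> vcomb m u c I = vcomb m u c' I"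
  by (simp add: vcomb_def)

text \<open>Extension of the coefficients by zero. It brings combinations over different subsets
  into one independent family, where coefficients can be compared.\<close>

lemma vcomb_superset:
  assumes "finite I" "J \<subseteq> I"
  shows "vcomb m u c J = vcomb m u (\<lambda>i. if i \<in> J then c i else 0) I"
proof -
  have "(\<Sum>i\<in>I. (if i \<in> J then c i else 0) * u i $ j) = (\<Sum>i\<in>J. c i * u i $ j)" for j
    using assms by (intro sum.mono_neutral_cong_right) auto
  then show ?thesis by (simp add: vcomb_def)
qed

lemma vcomb_eqD:
  fixes u :: "'i \<Rightarrow> 'a::field vec"
  assumes "indep_family m u I" "vcomb m u c I = vcomb m u c' I" "i \<in> I"
  shows "c i = c' i"
proof -
  have "vcomb m u (\<lambda>i. c i - c' i) I = 0\<^sub>v m"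
  proof (rule eq_vecI)
    fix j assume "j < dim_vec (0\<^sub>v m :: 'a vec)"
    moreover have "vcomb m u c I $ j = vcomb m u c' I $ j" using assms(2) by simp
    ultimately show "vcomb m u (\<lambda>i. c i - c' i) I $ j = 0\<^sub>v m $ j"
      by (simp add: vcomb_def left_diff_distrib sum_subtractf)
  qed simp
  then show ?thesis using assms(1,3) by (auto simp: indep_family_def)
qed

lemma indep_family_subset:
  assumes "indep_family m u I" "finite I" "J \<subseteq> I"
  shows "indep_family m u J"
  unfolding indep_family_def
proof (intro allI impI ballI)
  fix c i assume "vcomb m u c J = 0\<^sub>v m" "i \<in> J"
  then show "c i = 0"
    using assms vcomb_superset[OF assms(2,3), of m u c] unfolding indep_family_def
    by (metis (mono_tags, lifting) subsetD)
qed

lemma vcomb_single: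
  assumes "finite I" "i \<in> I" "u i \<in> carrier_vec m"
  shows "vcomb m u (\<lambda>j. if j = i then a else 0) I = a \<cdot>\<^sub>v u i"
  by (rule eq_vecI) (use assms in \<open>auto simp: vcomb_def if_distrib[of "\<lambda>x. x * _"] cong: if_cong\<close>)

lemma vcomb_unit:
  assumes "finite I" "i \<in> I" "u i \<in> carrier_vec m"
  shows "vcomb m u (\<lambda>j. if j = i then 1 else 0) I = u i"
  using vcomb_single[of I i u m 1] assms by simp

lemma indep_family_inj:
  assumes "indep_family m u I" "finite I" "u ` I \<subseteq> carrier_vec m"
  shows "inj_on u I"
proof (rule inj_onI)
  fix i i' assume i: "i \<in> I" "i' \<in> I" and eq: "u i = u i'"
  have "vcomb m u (\<lambda>j. if j = i then 1 else 0) I = vcomb m u (\<lambda>j. if j = i' then 1 else 0) I"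
    using assms i eq by (simp add: vcomb_unit image_subset_iff)
  from vcomb_eqD[OF assms(1) this i(1)] show "i = i'" by (simp split: if_splits)
qed

lemma vcomb_singleton:
  assumes "u i \<in> carrier_vec m"
  shows "vcomb m u c {i} = c i \<cdot>\<^sub>v u i"
  by (rule eq_vecI) (use assms in \<open>auto simp: vcomb_def\<close>)

lemma vcomb_vanish_superset:
  assumes "finite I" "\<And>i. i \<in> I - J \<Longrightarrow> u i = 0\<^sub>v m" "J \<subseteq> I"
  shows "vcomb m u c I = vcomb m u c J"
proof (rule eq_vecI)
  fix j assume "j < dim_vec (vcomb m u c J)"
  then have "j < m" by simp
  then show "vcomb m u c I $ j = vcomb m u c J $ j"
    using assms by (auto simp: vcomb_def intro!: sum.mono_neutral_right)
qed simp

section \<open>Comparison with independence, span and dimension of sets of vectors\<close>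

lemma vcomb_eq_lincomb:
  assumes "inj_on u I" "finite I" "u ` I \<subseteq> carrier_vec m"
  shows "vcomb m u (\<lambda>i. a (u i)) I =
    LinearCombinations.module.lincomb (module_vec TYPE('a::field) m) a (u ` I)"
proof -
  interpret vec_space "TYPE('a)" m .
  have d: "dim_vec (lincomb a (u ` I)) = m"
    using assms lincomb_dim[of "u ` I" a] by simp
  show ?thesis
    by (rule eq_vecI) (use assms in \<open>auto simp: d vcomb_def lincomb_index sum.reindex\<close>)
qed

lemma indep_family_lin_indpt:
  fixes u :: "'i \<Rightarrow> 'a::field vec"
  assumes "indep_family m u I" "finite I" "u ` I \<subseteq> carrier_vec m"
  shows "vlin_indpt m (u ` I)"
proof -
  interpret vec_space "TYPE('a)" m .
  have inj: "inj_on u I" by (rule indep_family_inj[OF assms])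
  show ?thesis
  proof
    assume "lin_dep (u ` I)"
    then obtain a w where a: "lincomb a (u ` I) = 0\<^sub>v m" "w \<in> u ` I" "a w \<noteq> 0"
      using finite_lin_dep[of "u ` I"] assms by auto
    then have "vcomb m u (\<lambda>i. a (u i)) I = 0\<^sub>v m"
      using vcomb_eq_lincomb[OF inj assms(2,3)] by simp
    with a(2,3) show False
      using assms(1) by (auto simp: indep_family_def)
  qed
qed

lemma lin_indpt_indep_family:
  fixes S :: "'a::field vec set"
  assumes "vlin_indpt m S" "finite S" "S \<subseteq> carrier_vec m"
  shows "indep_family m (\<lambda>v. v) S"
proof -
  interpret vec_space "TYPE('a)" m .
  show ?thesis
    unfolding indep_family_def
  proof (intro allI impI ballI, rule ccontr)
    fix c v assume "vcomb m (\<lambda>v. v) c S = 0\<^sub>v m" "v \<in> S" "c v \<noteq> 0"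
    moreover from this(1) have "lincomb c S = 0\<^sub>v m"
      using vcomb_eq_lincomb[of "\<lambda>v. v" S m c] assms by simp
    ultimately have "lin_dep S"
      using lin_dep_crit[of S S v c] assms by auto
    with assms(1) show False by simp
  qed
qed

text \<open>The last two hypotheses squeeze \<open>S\<close> between the family and its span, so all
  three have the same span. In this form the lemma applies to cones and to coordinate subspaces
  alike.\<close>

lemma lin_dim_eq_card:
  fixes u :: "'i \<Rightarrow> 'a::field vec"
  assumes "indep_family m u I" "finite I" "u ` I \<subseteq> S" "S \<subseteq> range (\<lambda>c. vcomb m u c I)"
  shows "lin_dim m S = card I"
proof -
  interpret vec_space "TYPE('a)" m .
  have S: "S \<subseteq> carrier_vec m" using assms(4) vcomb_carrier by blast
  have uI: "u ` I \<subseteq> carrier_vec m" using assms(3) S by blast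
  have inj: "inj_on u I" by (rule indep_family_inj[OF assms(1,2) uI])
  have "S \<subseteq> span (u ` I)"
  proof
    fix x assume "x \<in> S"
    then obtain c where "x = vcomb m u c I" using assms(4) by auto
    \<comment> \<open>The coefficients move from labels to vectors, which is possible because
      \<open>u\<close> is injective on \<open>I\<close>.\<close>
    also have "\<dots> = vcomb m u (\<lambda>i. (\<lambda>v. c (inv_into I u v)) (u i)) I"
      by (rule vcomb_cong) (simp add: inv_into_f_f[OF inj])
    finally show "x \<in> span (u ` I)"
      using vcomb_eq_lincomb[OF inj assms(2) uI] finite_span[of "u ` I"] assms(2) uI
      by fastforce
  qed
  then have span: "span S = span (u ` I)"
    using span_is_monotone[OF assms(3)] span_is_subset[OF _ span_is_submodule[of "u ` I"], of S] uI
    by auto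
  have "vectorspace.dim class_ring (span_vs (u ` I)) = card (u ` I)"
    using uI assms(2) indep_family_lin_indpt[OF assms(1,2) uI]
    by (intro dim_span) (auto simp: maximal_def)
  then show ?thesis by (simp add: lin_dim_def span card_image[OF inj])
qed

lemma card_indep_family_le:
  fixes u :: "'i \<Rightarrow> 'a::field vec"
  assumes "indep_family m u I" "finite I" "u ` I \<subseteq> carrier_vec m"
  shows "card I \<le> m"
proof -
  interpret vec_space "TYPE('a)" m .
  have "card (u ` I) \<le> dim"
    using li_le_dim(2)[of "u ` I"] indep_family_lin_indpt[OF assms] assms(3) by auto
  then show ?thesis
    by (simp add: dim_is_n card_image[OF indep_family_inj[OF assms]])
qed

lemma lin_dim_coordinate_subspace:
  assumes "I \<subseteq> {..<n}"
  shows "lin_dim n {x \<in> carrier_vec n. \<forall>i<n. i \<notin> I \<longrightarrow> x $ i = (0 :: 'a::field)} = card I"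
proof (rule lin_dim_eq_card[of n "unit_vec n"])
  have fin: "finite I" using assms finite_subset by blast
  have comb: "vcomb n (unit_vec n) c I $ j = (if j \<in> I then c j else 0)" if "j < n" for c :: "nat \<Rightarrow> 'a" and j
  proof -
    have "(\<Sum>i\<in>I. c i * unit_vec n i $ j) = (\<Sum>i\<in>I. if i = j then c i else 0)"
      using that assms by (intro sum.cong) auto
    then show ?thesis using fin that by (simp add: vcomb_def)
  qed
  show "indep_family n (unit_vec n :: nat \<Rightarrow> 'a vec) I"
    unfolding indep_family_def
  proof (intro allI impI ballI)
    fix c :: "nat \<Rightarrow> 'a" and i assume c: "vcomb n (unit_vec n) c I = 0\<^sub>v n" and i: "i \<in> I"
    then have "i < n" using assms by auto
    then show "c i = 0" using comb[of i c] i by (simp add: c)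
  qed
  show "finite I" by (rule fin)
  show "unit_vec n ` I \<subseteq> {x \<in> carrier_vec n. \<forall>i<n. i \<notin> I \<longrightarrow> x $ i = (0 :: 'a)}"
    using assms by auto
  show "{x \<in> carrier_vec n. \<forall>i<n. i \<notin> I \<longrightarrow> x $ i = (0 :: 'a)} \<subseteq> range (\<lambda>c. vcomb n (unit_vec n) c I)"
  proof
    fix x assume x: "x \<in> {x \<in> carrier_vec n. \<forall>i<n. i \<notin> I \<longrightarrow> x $ i = (0 :: 'a)}"
    have "x = vcomb n (unit_vec n) (($) x) I"
      by (rule eq_vecI) (use x in \<open>auto simp: comb\<close>)
    then show "x \<in> range (\<lambda>c. vcomb n (unit_vec n) c I)" by blast
  qed
qed

section \<open>Linear functionals with prescribed values on an independent family\<close>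

lemma scalar_prod_vcomb:
  assumes "y \<in> carrier_vec m" "u ` I \<subseteq> carrier_vec m"
  shows "y \<bullet> vcomb m u c I = (\<Sum>i\<in>I. c i * (y \<bullet> u i))"
proof -
  have "y \<bullet> vcomb m u c I = (\<Sum>j<m. \<Sum>i\<in>I. c i * (y $ j * u i $ j))"
    by (simp add: scalar_prod_def vcomb_def sum_distrib_left atLeast0LessThan mult_ac)
  also have "\<dots> = (\<Sum>i\<in>I. c i * (\<Sum>j<m. y $ j * u i $ j))"
    by (subst sum.swap) (simp add: sum_distrib_left)
  also have "\<dots> = (\<Sum>i\<in>I. c i * (y \<bullet> u i))"
    using assms by (intro sum.cong) (auto simp: scalar_prod_def atLeast0LessThan)
  finally show ?thesis .
qed

text \<open>Induction on \<open>I\<close> with arbitrary values \<open>b\<close>: a vector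
  \<open>z\<close> orthogonal to the old vectors but not to the new one adjusts the value at the new
  one. Later such functionals cut out the faces of a simplicial cone.\<close>

lemma exists_dual_vector:
  fixes u :: "'i \<Rightarrow> 'a::field vec"
  assumes "finite I" "indep_family m u I" "u ` I \<subseteq> carrier_vec m"
  shows "\<exists>y\<in>carrier_vec m. \<forall>i\<in>I. y \<bullet> u i = b i"
  using assms
proof (induction I arbitrary: b)
  case empty
  show ?case using zero_carrier_vec by blast
next
  case (insert i I)
  have "indep_family m u I"
    using indep_family_subset[OF insert.prems(1), of I] insert.hyps by auto
  with insert have IH: "\<exists>y\<in>carrier_vec m. \<forall>i\<in>I. y \<bullet> u i = b i" for b by auto
  \<comment> \<open>The induction hypothesis with values 0 and 1 yields \<open>Y\<close>, dual to
    the vectors labelled by \<open>I\<close>.\<close>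
  have "\<forall>j. \<exists>y\<in>carrier_vec m. \<forall>l\<in>I. y \<bullet> u l = (if l = j then 1 else 0)"
    by (intro allI IH)
  then obtain Y where Y: "Y j \<in> carrier_vec m" "\<And>l. l \<in> I \<Longrightarrow> Y j \<bullet> u l = (if l = j then 1 else 0)" for j
    by metis
  have u: "u j \<in> carrier_vec m" if "j \<in> insert i I" for j using insert.prems that by auto
  \<comment> \<open>Otherwise every \<open>y\<close> has the same product with \<open>u i\<close> as with \<open>\<Sum>j\<in>I. (Y j \<bullet> u i) u j\<close>,
    so \<open>u i\<close> depends on the other vectors.\<close>
  have "\<exists>z\<in>carrier_vec m. (\<forall>l\<in>I. z \<bullet> u l = 0) \<and> z \<bullet> u i \<noteq> 0"
  proof (rule ccontr)
    assume no: "\<not> ?thesis"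
    let ?c = "\<lambda>j. if j = i then - 1 else Y j \<bullet> u i"
    have "vcomb m u ?c (insert i I) = 0\<^sub>v m"
    proof (rule eq_vecI)
      fix t assume "t < dim_vec (0\<^sub>v m :: 'a vec)"
      then have t: "t < m" by simp
      \<comment> \<open>\<open>?w\<close> is chosen so that \<open>unit_vec m t - ?w\<close> is
        orthogonal to every old vector. By assumption it is then orthogonal to \<open>u i\<close>
        too, which is coordinate \<open>t\<close> of the dependence.\<close>
      let ?w = "vcomb m Y (\<lambda>j. u j $ t) I"
      have w: "?w \<bullet> u l = (\<Sum>j\<in>I. u j $ t * (Y j \<bullet> u l))" if "l \<in> insert i I" for l
      proof -
        have "?w \<bullet> u l = u l \<bullet> ?w" using u[OF that] by (simp add: comm_scalar_prod[of _ m])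
        also have "\<dots> = (\<Sum>j\<in>I. u j $ t * (u l \<bullet> Y j))"
          using u[OF that] Y by (intro scalar_prod_vcomb) auto
        also have "\<dots> = (\<Sum>j\<in>I. u j $ t * (Y j \<bullet> u l))"
          using u[OF that] Y by (simp add: comm_scalar_prod[of _ m])
        finally show ?thesis .
      qed
      have z: "(unit_vec m t - ?w) \<bullet> u l = u l $ t - (\<Sum>j\<in>I. u j $ t * (Y j \<bullet> u l))"
        if "l \<in> insert i I" for l
        using u[OF that] t by (simp add: minus_scalar_prod_distrib[of _ m] w[OF that])
      have "(unit_vec m t - ?w) \<bullet> u l = 0" if "l \<in> I" for l
      proof -
        have "(\<Sum>j\<in>I. u j $ t * (Y j \<bullet> u l)) = (\<Sum>j\<in>I. if j = l then u j $ t else 0)"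
          using Y that by (intro sum.cong) auto
        then show ?thesis using that insert.hyps z by simp
      qed
      then have "(unit_vec m t - ?w) \<bullet> u i = 0"
        using no minus_carrier_vec[OF unit_vec_carrier[of m t] vcomb_carrier[of m Y "\<lambda>j. u j $ t" I]] by blast
      then have "u i $ t = (\<Sum>j\<in>I. u j $ t * (Y j \<bullet> u i))" using z by simp
      also have "\<dots> = (\<Sum>j\<in>I. ?c j * u j $ t)"
        using insert.hyps by (intro sum.cong) auto
      finally show "vcomb m u ?c (insert i I) $ t = 0\<^sub>v m $ t"
        using insert.hyps t by (simp add: vcomb_def)
    qed simp
    then have "?c i = 0" using insert.prems(1) unfolding indep_family_def by blast
    then show False by simp
  qed
  then obtain z where z: "z \<in> carrier_vec m" "\<And>l. l \<in> I \<Longrightarrow> z \<bullet> u l = 0" "z \<bullet> u i \<noteq> 0"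
    by auto
  obtain y where y: "y \<in> carrier_vec m" "\<And>l. l \<in> I \<Longrightarrow> y \<bullet> u l = b l" using IH by blast
  \<comment> \<open>A multiple of \<open>z\<close> corrects the value at \<open>u i\<close> and
    leaves the values on \<open>I\<close> unchanged.\<close>
  let ?y = "y + ((b i - y \<bullet> u i) / (z \<bullet> u i)) \<cdot>\<^sub>v z"
  have "?y \<bullet> u l = b l" if "l \<in> insert i I" for l
    using y z u[OF that] that by (auto simp: add_scalar_prod_distrib[of _ m])
  moreover have "?y \<in> carrier_vec m" using y z by simp
  ultimately show ?case by blast
qed

section \<open>Simplicial cones\<close>

definition family_cone :: "nat \<Rightarrow> ('i \<Rightarrow> real vec) \<Rightarrow> 'i set \<Rightarrow> real vec set" where
  "family_cone m u I = {vcomb m u c I | c. \<forall>i\<in>I. 0 \<le> c i}"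

lemma family_cone_carrier: "family_cone m u I \<subseteq> carrier_vec m"
  by (auto simp: family_cone_def)

lemma generator_in_family_cone:
  assumes "finite I" "i \<in> I" "u i \<in> carrier_vec m"
  shows "u i \<in> family_cone m u I"
  unfolding family_cone_def using vcomb_unit[of I i u m, symmetric] assms by fastforce

lemma cone_gen_eq_family_cone:
  assumes "finite S" "S \<subseteq> carrier_vec m"
  shows "cone_gen m S = family_cone m (\<lambda>v. v) S"
proof -
  have "finsum_vec TYPE(real) m (\<lambda>v. c v \<cdot>\<^sub>v v) S = vcomb m (\<lambda>v. v) c S" for c
  proof (rule eq_vecI)
    have car: "finsum_vec TYPE(real) m (\<lambda>v. c v \<cdot>\<^sub>v v) S \<in> carrier_vec m"
      using assms by (intro finsum_vec_closed) auto
    then show "dim_vec (finsum_vec TYPE(real) m (\<lambda>v. c v \<cdot>\<^sub>v v) S) = dim_vec (vcomb m (\<lambda>v. v) c S)"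
      by simp
    fix j assume "j < dim_vec (vcomb m (\<lambda>v. v) c S)"
    then have j: "j < m" by simp
    have "finsum_vec TYPE(real) m (\<lambda>v. c v \<cdot>\<^sub>v v) S $ j = (\<Sum>v\<in>S. (c v \<cdot>\<^sub>v v) $ j)"
      using assms j by (intro index_finsum_vec) auto
    also have "\<dots> = (\<Sum>v\<in>S. c v * v $ j)"
      using assms j by (intro sum.cong) auto
    finally show "finsum_vec TYPE(real) m (\<lambda>v. c v \<cdot>\<^sub>v v) S $ j = vcomb m (\<lambda>v. v) c S $ j"
      using j by (simp add: vcomb_def)
  qed
  then show ?thesis by (simp add: cone_gen_def family_cone_def)
qed

lemma lin_dim_family_cone:
  assumes "indep_family m u I" "finite I" "u ` I \<subseteq> carrier_vec m"
  shows "lin_dim m (family_cone m u I) = card I"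
proof (rule lin_dim_eq_card[OF assms(1,2)])
  show "u ` I \<subseteq> family_cone m u I"
    by (intro image_subsetI generator_in_family_cone[OF assms(2)]) (use assms(3) in auto)
qed (auto simp: family_cone_def)

section \<open>Faces and rays of simplicial cones\<close>

text \<open>A sum of nonnegative terms vanishes only if every term does, so a point of the cone
  orthogonal to \<open>y\<close> has nonzero coefficients only at generators orthogonal to
  \<open>y\<close>.\<close>

lemma vanishing_part_family_cone:
  assumes "finite I" "u ` I \<subseteq> carrier_vec m" "y \<in> carrier_vec m" "\<And>i. i \<in> I \<Longrightarrow> 0 \<le> y \<bullet> u i"
  shows "{x \<in> family_cone m u I. y \<bullet> x = 0} = family_cone m u {i \<in> I. y \<bullet> u i = 0}" (is "?L = ?R")
    and "\<And>x. x \<in> family_cone m u I \<Longrightarrow> 0 \<le> y \<bullet> x"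
proof -
  let ?J = "{i \<in> I. y \<bullet> u i = 0}"
  note sp = scalar_prod_vcomb[OF assms(3,2)]
  show "0 \<le> y \<bullet> x" if "x \<in> family_cone m u I" for x
    using that assms(4) by (auto simp: family_cone_def sp intro!: sum_nonneg)
  show "?L = ?R"
  proof (intro equalityI subsetI)
    fix x assume "x \<in> ?L"
    then obtain c where c: "\<forall>i\<in>I. 0 \<le> c i" "x = vcomb m u c I" "y \<bullet> x = 0"
      by (auto simp: family_cone_def)
    then have "(\<Sum>i\<in>I. c i * (y \<bullet> u i)) = 0" by (simp add: sp)
    then have "\<forall>i\<in>I. c i * (y \<bullet> u i) = 0"
      using assms c by (subst (asm) sum_nonneg_eq_0_iff) auto
    then have "vcomb m u c I = vcomb m u (\<lambda>i. if i \<in> ?J then c i else 0) I"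
      by (intro vcomb_cong) auto
    also have "\<dots> = vcomb m u c ?J"
      using assms(1) by (intro vcomb_superset[symmetric]) auto
    finally show "x \<in> ?R" using c by (auto simp: family_cone_def)
  next
    fix x assume "x \<in> ?R"
    then obtain c where c: "\<forall>i\<in>?J. 0 \<le> c i" "x = vcomb m u c ?J"
      by (auto simp: family_cone_def)
    then have x: "x = vcomb m u (\<lambda>i. if i \<in> ?J then c i else 0) I"
      using vcomb_superset[OF assms(1), of ?J] by simp
    have "y \<bullet> x = 0" unfolding x sp by (intro sum.neutral) auto
    then show "x \<in> ?L" using x c by (auto simp: family_cone_def)
  qed
qed

text \<open>The functional defining a face selects the generators on which it vanishes. Conversely,
  a functional with value 0 on \<open>J\<close> and 1 on the other generators cuts out the subcone
  on \<open>J\<close>.\<close>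

lemma cone_face_family_cone_iff:
  assumes "indep_family m u I" "finite I" "u ` I \<subseteq> carrier_vec m"
  shows "cone_face m F (family_cone m u I) \<longleftrightarrow> (\<exists>J\<subseteq>I. F = family_cone m u J)"
proof
  assume "cone_face m F (family_cone m u I)"
  then obtain y where y: "y \<in> carrier_vec m" "\<forall>x\<in>family_cone m u I. 0 \<le> y \<bullet> x"
    "F = {x\<in>family_cone m u I. y \<bullet> x = 0}"
    by (auto simp: cone_face_def)
  have "0 \<le> y \<bullet> u i" if "i \<in> I" for i
  proof (rule bspec[OF y(2)])
    show "u i \<in> family_cone m u I"
      by (rule generator_in_family_cone[OF assms(2) that]) (use assms(3) that in auto)
  qed
  then have "F = family_cone m u {i \<in> I. y \<bullet> u i = 0}"
    unfolding y(3) by (rule vanishing_part_family_cone(1)[OF assms(2,3) y(1)])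
  then show "\<exists>J\<subseteq>I. F = family_cone m u J"
    by (intro exI[of _ "{i \<in> I. y \<bullet> u i = 0}"]) simp
next
  assume "\<exists>J\<subseteq>I. F = family_cone m u J"
  then obtain J where J: "J \<subseteq> I" "F = family_cone m u J" by blast
  obtain y where y: "y \<in> carrier_vec m" "\<forall>i\<in>I. y \<bullet> u i = (if i \<in> J then 0 else 1)"
    using exists_dual_vector[OF assms(2,1,3), of "\<lambda>i. if i \<in> J then 0 else 1"] by blast
  have J_eq: "{i \<in> I. y \<bullet> u i = 0} = J" using y J by (auto split: if_splits)
  have nonneg: "0 \<le> y \<bullet> u i" if "i \<in> I" for i using y that by simp
  have "F = {x\<in>family_cone m u I. y \<bullet> x = 0}"
    using vanishing_part_family_cone(1)[OF assms(2,3) y(1) nonneg] J J_eq by simp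
  moreover have "\<forall>x\<in>family_cone m u I. 0 \<le> y \<bullet> x"
    using vanishing_part_family_cone(2)[OF assms(2,3) y(1) nonneg] by blast
  ultimately show "cone_face m F (family_cone m u I)"
    using y(1) unfolding cone_face_def by blast
qed

text \<open>By uniqueness of coefficients; hence different subsets of the generators span different
  faces.\<close>

lemma generator_mem_subcone_iff:
  assumes "indep_family m u I" "finite I" "u ` I \<subseteq> carrier_vec m" "i \<in> I" "J \<subseteq> I"
  shows "u i \<in> family_cone m u J \<longleftrightarrow> i \<in> J"
proof
  assume "u i \<in> family_cone m u J"
  then obtain c where "u i = vcomb m u c J" by (auto simp: family_cone_def)
  then have "vcomb m u (\<lambda>l. if l = i then 1 else 0) I = vcomb m u (\<lambda>l. if l \<in> J then c l else 0) I"
    using vcomb_superset[OF assms(2,5)] vcomb_unit[OF assms(2,4), of u m] assms by auto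
  from vcomb_eqD[OF assms(1) this assms(4)] show "i \<in> J" by (simp split: if_splits)
next
  assume "i \<in> J"
  then show "u i \<in> family_cone m u J"
    using finite_subset[OF assms(5,2)] assms(3,4) by (intro generator_in_family_cone) auto
qed

lemma family_cone_inj:
  assumes "indep_family m u I" "finite I" "u ` I \<subseteq> carrier_vec m" "J \<subseteq> I" "J' \<subseteq> I"
    and "family_cone m u J = family_cone m u J'"
  shows "J = J'"
proof -
  have "i \<in> J \<longleftrightarrow> i \<in> J'" if "i \<in> I" for i
    using generator_mem_subcone_iff[OF assms(1-3) that assms(4)]
      generator_mem_subcone_iff[OF assms(1-3) that assms(5)] assms(6) by simp
  then show ?thesis using assms(4,5) by blast
qed

text \<open>The dimension of a face is the number of its generators, so the one-dimensional faces
  are those with a single generator.\<close>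

lemma rays_family_cone:
  assumes "indep_family m u I" "finite I" "u ` I \<subseteq> carrier_vec m"
  shows "rays m (family_cone m u I) = (\<lambda>i. family_cone m u {i}) ` I"
proof -
  have dim: "lin_dim m (family_cone m u J) = card J" if "J \<subseteq> I" for J
    using that assms finite_subset[OF that assms(2)]
    by (intro lin_dim_family_cone indep_family_subset[OF assms(1,2)]) auto
  show ?thesis
    unfolding rays_def cone_face_family_cone_iff[OF assms]
    by (auto simp: dim card_1_singleton_iff)
qed

section \<open>Dropping zero generators and rescaling the others\<close>

lemma family_cone_vanish_superset:
  assumes "finite I" "\<And>i. i \<in> I - J \<Longrightarrow> u i = 0\<^sub>v m" "J \<subseteq> I"
  shows "family_cone m u I = family_cone m u J"
proof (intro equalityI subsetI)
  fix x assume "x \<in> family_cone m u I"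
  then obtain c where c: "\<forall>i\<in>I. 0 \<le> c i" "x = vcomb m u c I" by (auto simp: family_cone_def)
  then have "x = vcomb m u c J"
    using vcomb_vanish_superset[of I J u m c] assms by simp
  then show "x \<in> family_cone m u J" using c(1) assms(3) by (auto simp: family_cone_def)
next
  fix x assume "x \<in> family_cone m u J"
  then obtain c where c: "\<forall>i\<in>J. 0 \<le> c i" "x = vcomb m u c J" by (auto simp: family_cone_def)
  then have "x = vcomb m u (\<lambda>i. if i \<in> J then c i else 0) I"
    using vcomb_superset[OF assms(1,3)] by simp
  then show "x \<in> family_cone m u I" using c(1) by (auto simp: family_cone_def)
qed

text \<open>The factors \<open>a\<close> move into the coefficients. The relabelling
  \<open>f\<close> serves to pass between generators labelled by themselves and generators labelled
  by the rays they span.\<close>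

lemma vcomb_scale:
  fixes u :: "'i \<Rightarrow> 'a::field vec"
  assumes "inj_on f I" "\<And>i. i \<in> I \<Longrightarrow> u' (f i) = a i \<cdot>\<^sub>v u i" "u ` I \<subseteq> carrier_vec m"
  shows "vcomb m u' c (f ` I) = vcomb m u (\<lambda>i. c (f i) * a i) I"
proof (rule eq_vecI)
  fix j assume "j < dim_vec (vcomb m u (\<lambda>i. c (f i) * a i) I)"
  then have j: "j < m" by simp
  have "(\<Sum>i\<in>I. c (f i) * u' (f i) $ j) = (\<Sum>i\<in>I. c (f i) * a i * u i $ j)"
    using assms j by (intro sum.cong) (auto simp: image_subset_iff)
  then show "vcomb m u' c (f ` I) $ j = vcomb m u (\<lambda>i. c (f i) * a i) I $ j"
    using j by (simp add: vcomb_def sum.reindex[OF assms(1)])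
qed simp

lemma indep_family_scale:
  fixes u :: "'i \<Rightarrow> 'a::field vec"
  assumes "inj_on f I" "\<And>i. i \<in> I \<Longrightarrow> u' (f i) = a i \<cdot>\<^sub>v u i" "u ` I \<subseteq> carrier_vec m"
    and "\<And>i. i \<in> I \<Longrightarrow> a i \<noteq> 0" "indep_family m u I"
  shows "indep_family m u' (f ` I)"
  using assms(4,5) vcomb_scale[OF assms(1-3)] by (fastforce simp: indep_family_def)

lemma family_cone_scale:
  assumes "inj_on f I" "\<And>i. i \<in> I \<Longrightarrow> u' (f i) = a i \<cdot>\<^sub>v u i" "u ` I \<subseteq> carrier_vec m"
    and "\<And>i. i \<in> I \<Longrightarrow> 0 < a i"
  shows "family_cone m u' (f ` I) = family_cone m u I"
proof (intro equalityI subsetI)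
  fix x assume "x \<in> family_cone m u' (f ` I)"
  then obtain c where c: "\<forall>i\<in>f ` I. 0 \<le> c i" "x = vcomb m u' c (f ` I)"
    by (auto simp: family_cone_def)
  then have "x = vcomb m u (\<lambda>i. c (f i) * a i) I"
    using vcomb_scale[OF assms(1-3)] by simp
  moreover have "\<forall>i\<in>I. 0 \<le> c (f i) * a i" using c assms(4) by (auto intro: mult_nonneg_nonneg less_imp_le)
  ultimately show "x \<in> family_cone m u I" by (auto simp: family_cone_def)
next
  fix x assume "x \<in> family_cone m u I"
  then obtain c where c: "\<forall>i\<in>I. 0 \<le> c i" "x = vcomb m u c I"
    by (auto simp: family_cone_def)
  let ?c = "\<lambda>j. c (inv_into I f j) / a (inv_into I f j)"
  have "vcomb m u' ?c (f ` I) = vcomb m u (\<lambda>i. ?c (f i) * a i) I"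
    by (rule vcomb_scale[OF assms(1-3)])
  also have "\<dots> = vcomb m u c I"
    using assms(4) by (intro vcomb_cong) (auto simp: inv_into_f_f[OF assms(1)] less_imp_neq[symmetric])
  finally have "x = vcomb m u' ?c (f ` I)" using c by simp
  moreover have "\<forall>j\<in>f ` I. 0 \<le> ?c j"
    using c assms(4) by (auto simp: inv_into_f_f[OF assms(1)] intro!: divide_nonneg_pos)
  ultimately show "x \<in> family_cone m u' (f ` I)" by (auto simp: family_cone_def)
qed

section \<open>Fans with a ray matrix\<close>

locale rayed_fan =
  fixes d :: nat and \<Sigma> :: "real vec set set" and rs :: "real vec set list" and U :: "real mat"
  assumes fan: "simplicial_fan d \<Sigma>" and ray_matrix: "ray_matrix d \<Sigma> rs U"
begin

definition ray_index :: "real vec set \<Rightarrow> nat" where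
  "ray_index = inv_into {..<length rs} ((!) rs)"

text \<open>This is the row \<open>u_\<rho>\<close>; it is meaningful only for rays of the
  fan.\<close>

definition gen :: "real vec set \<Rightarrow> real vec" where
  "gen \<rho> = row U (ray_index \<rho>)"

lemma distinct_rs: "distinct rs" and set_rs: "set rs = cones d \<Sigma> 1"
  and U_carrier: "U \<in> carrier_mat (length rs) d"
  using ray_matrix by (auto simp: ray_matrix_def)

lemma ray_index_nth: "i < length rs \<Longrightarrow> ray_index (rs ! i) = i"
  unfolding ray_index_def
  by (rule inv_into_f_f) (auto simp: inj_on_def nth_eq_iff_index_eq[OF distinct_rs])

lemma gen_nth: "i < length rs \<Longrightarrow> gen (rs ! i) = row U i"
  by (simp add: gen_def ray_index_nth)

lemma ray_nth: "\<rho> \<in> cones d \<Sigma> 1 \<Longrightarrow> \<exists>i<length rs. rs ! i = \<rho>"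
  by (metis in_set_conv_nth set_rs)

lemma gen_carrier: "\<rho> \<in> cones d \<Sigma> 1 \<Longrightarrow> gen \<rho> \<in> carrier_vec d"
  using U_carrier ray_nth[of \<rho>] by (auto simp: gen_nth)

lemma gen_nonzero: "\<rho> \<in> cones d \<Sigma> 1 \<Longrightarrow> gen \<rho> \<noteq> 0\<^sub>v d"
  using ray_matrix unfolding ray_matrix_def by (metis gen_nth in_set_conv_nth)

lemma ray_eq:
  assumes "\<rho> \<in> cones d \<Sigma> 1"
  shows "family_cone d gen {\<rho>} = \<rho>"
proof -
  obtain i where i: "i < length rs" "\<rho> = rs ! i"
    using ray_nth[OF assms] by auto
  have "\<rho> = cone_gen d {gen \<rho>}"
    using ray_matrix i gen_nth[OF i(1)] unfolding ray_matrix_def by metis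
  also have "\<dots> = family_cone d (\<lambda>v. v) {gen \<rho>}"
    using gen_carrier[OF assms] by (intro cone_gen_eq_family_cone) auto
  also have "\<dots> = family_cone d gen {\<rho>}"
    using family_cone_scale[of gen "{\<rho>}" "\<lambda>v. v" "\<lambda>_. 1" gen d] gen_carrier[OF assms] by auto
  finally show ?thesis ..
qed

lemma face_in_fan: "\<sigma> \<in> \<Sigma> \<Longrightarrow> cone_face d F \<sigma> \<Longrightarrow> F \<in> \<Sigma>"
  using fan unfolding simplicial_fan_def polyhedral_fan_def by blast

lemma inter_face: "\<sigma> \<in> \<Sigma> \<Longrightarrow> \<sigma>' \<in> \<Sigma> \<Longrightarrow> cone_face d (\<sigma> \<inter> \<sigma>') \<sigma>"
  using fan unfolding simplicial_fan_def polyhedral_fan_def by blast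

lemma finite_fan: "finite \<Sigma>"
  using fan unfolding simplicial_fan_def polyhedral_fan_def by blast

lemma rays_subset: "\<sigma> \<in> \<Sigma> \<Longrightarrow> rays d \<sigma> \<subseteq> cones d \<Sigma> 1"
  using face_in_fan by (auto simp: rays_def cones_def)

lemma finite_cones: "finite (cones d \<Sigma> j)"
  using finite_fan by (simp add: cones_def)

lemma finite_rays: "\<sigma> \<in> \<Sigma> \<Longrightarrow> finite (rays d \<sigma>)"
  using rays_subset finite_cones finite_subset by blast

lemma gen_rays_carrier: "\<sigma> \<in> \<Sigma> \<Longrightarrow> gen ` rays d \<sigma> \<subseteq> carrier_vec d"
  using rays_subset gen_carrier by blast

section \<open>Cones and faces as sets of rays\<close>

text \<open>The fan provides each cone with some independent generators \<open>S\<close>. Each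
  \<open>v\<close> in \<open>S\<close> spans a ray of the fan, and the row of that ray is a nonzero
  point of it, hence a positive multiple of \<open>v\<close>. Rescaling by these factors changes
  neither independence nor the cone.\<close>

lemma
  assumes "\<sigma> \<in> \<Sigma>"
  shows indep_rays: "indep_family d gen (rays d \<sigma>)"
    and cone_eq: "family_cone d gen (rays d \<sigma>) = \<sigma>"
proof -
  obtain S where S: "finite S" "S \<subseteq> carrier_vec d" "vlin_indpt d S" "\<sigma> = cone_gen d S"
    using fan assms unfolding simplicial_fan_def simplicial_cone_def by blast
  let ?id = "\<lambda>v :: real vec. v"
  define f where "f v = family_cone d ?id {v}" for v
  have \<sigma>: "\<sigma> = family_cone d ?id S" using S cone_gen_eq_family_cone by simp
  have idS: "?id ` S \<subseteq> carrier_vec d" using S by simp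
  have indep: "indep_family d ?id S" by (rule lin_indpt_indep_family[OF S(3,1,2)])
  have rays: "rays d \<sigma> = f ` S"
    unfolding \<sigma> f_def by (rule rays_family_cone[OF indep S(1) idS])
  have inj: "inj_on f S"
  proof (rule inj_onI)
    fix v v' assume "v \<in> S" "v' \<in> S" "f v = f v'"
    then show "v = v'"
      using family_cone_inj[OF indep S(1) idS, of "{v}" "{v'}"] by (simp add: f_def)
  qed
  have "\<exists>a>0. gen (f v) = a \<cdot>\<^sub>v v" if "v \<in> S" for v
  proof -
    have fv: "f v \<in> cones d \<Sigma> 1" using rays rays_subset[OF assms] that by blast
    have "gen (f v) \<in> family_cone d gen {f v}"
      using gen_carrier[OF fv] by (intro generator_in_family_cone) auto
    then have "gen (f v) \<in> family_cone d ?id {v}" using ray_eq[OF fv] f_def by simp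
    then obtain c where c: "0 \<le> c v" "gen (f v) = vcomb d ?id c {v}"
      by (auto simp: family_cone_def)
    have "v \<in> carrier_vec d" using that S by auto
    then have eq: "gen (f v) = c v \<cdot>\<^sub>v v"
      using c(2) vcomb_singleton[of ?id v d c] by simp
    have "c v \<noteq> 0"
    proof
      assume "c v = 0"
      then have "gen (f v) = 0\<^sub>v d" using eq \<open>v \<in> carrier_vec d\<close> by auto
      then show False using gen_nonzero[OF fv] by simp
    qed
    with c(1) eq show ?thesis by (intro exI[of _ "c v"]) simp
  qed
  then obtain a where a: "\<And>v. v \<in> S \<Longrightarrow> 0 < a v" "\<And>v. v \<in> S \<Longrightarrow> gen (f v) = a v \<cdot>\<^sub>v v"
    by metis
  show "indep_family d gen (rays d \<sigma>)"
    unfolding rays by (rule indep_family_scale[OF inj a(2) idS _ indep]) (use a(1) in fastforce)+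
  show "family_cone d gen (rays d \<sigma>) = \<sigma>"
    unfolding rays by (subst family_cone_scale[OF inj a(2) idS a(1)]) (simp_all add: \<sigma>)
qed

lemma card_rays: "\<sigma> \<in> \<Sigma> \<Longrightarrow> card (rays d \<sigma>) = lin_dim d \<sigma>"
  using lin_dim_family_cone[OF indep_rays finite_rays gen_rays_carrier] cone_eq by simp

lemma cone_eq_iff: "\<sigma> \<in> \<Sigma> \<Longrightarrow> \<sigma>' \<in> \<Sigma> \<Longrightarrow> rays d \<sigma> = rays d \<sigma>' \<longleftrightarrow> \<sigma> = \<sigma>'"
  using cone_eq by metis

text \<open>Any subset of the generators of \<sigma> spans a face, and the fan contains the faces of
  its cones.\<close>

lemma
  assumes "\<sigma> \<in> \<Sigma>" "J \<subseteq> rays d \<sigma>"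
  shows subcone_face: "cone_face d (family_cone d gen J) \<sigma>"
    and subcone_in_fan: "family_cone d gen J \<in> \<Sigma>"
    and rays_subcone: "rays d (family_cone d gen J) = J"
proof -
  show face: "cone_face d (family_cone d gen J) \<sigma>"
    using cone_face_family_cone_iff[OF indep_rays finite_rays gen_rays_carrier, OF assms(1) assms(1) assms(1)]
      assms cone_eq[OF assms(1)] by auto
  show "family_cone d gen J \<in> \<Sigma>" by (rule face_in_fan[OF assms(1) face])
  have J: "J \<subseteq> cones d \<Sigma> 1" "finite J"
    using assms rays_subset finite_rays finite_subset by blast+
  have "rays d (family_cone d gen J) = (\<lambda>\<rho>. family_cone d gen {\<rho>}) ` J"
    using J gen_carrier
    by (intro rays_family_cone indep_family_subset[OF indep_rays[OF assms(1)] finite_rays[OF assms(1)] assms(2)]) auto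
  also have "\<dots> = (\<lambda>\<rho>. \<rho>) ` J"
    using J(1) by (intro image_cong) (auto simp: ray_eq)
  finally show "rays d (family_cone d gen J) = J" by simp
qed

text \<open>Faces of \<sigma> are the subcones on subsets of its rays, and a cone of the fan is
  recovered from its rays. From here on the fan can be handled through sets of rays.\<close>

lemma face_iff:
  assumes "\<tau> \<in> \<Sigma>" "\<sigma> \<in> \<Sigma>"
  shows "cone_face d \<tau> \<sigma> \<longleftrightarrow> rays d \<tau> \<subseteq> rays d \<sigma>"
proof
  assume "cone_face d \<tau> \<sigma>"
  then obtain J where "J \<subseteq> rays d \<sigma>" "\<tau> = family_cone d gen J"
    using cone_face_family_cone_iff[OF indep_rays finite_rays gen_rays_carrier, OF assms(2) assms(2) assms(2)]
      cone_eq[OF assms(2)] by auto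
  then show "rays d \<tau> \<subseteq> rays d \<sigma>" using rays_subcone[OF assms(2)] by simp
next
  assume "rays d \<tau> \<subseteq> rays d \<sigma>"
  then show "cone_face d \<tau> \<sigma>" using subcone_face[OF assms(2)] cone_eq[OF assms(1)] by metis
qed

section \<open>Neighbouring rays\<close>

text \<open>The dimension condition in \<open>nb\<close> excludes the rays of \<tau>: adding one of
  them would leave the number of rays, hence the dimension, unchanged.\<close>

lemma nb_iff:
  assumes "\<tau> \<in> \<Sigma>"
  shows "\<rho> \<in> nb d \<Sigma> \<tau> \<longleftrightarrow> \<rho> \<notin> rays d \<tau> \<and> (\<exists>\<sigma>\<in>\<Sigma>. rays d \<sigma> = insert \<rho> (rays d \<tau>))"
proof
  assume "\<rho> \<in> nb d \<Sigma> \<tau>"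
  then obtain \<sigma> where \<sigma>: "\<sigma> \<in> \<Sigma>" "lin_dim d \<sigma> = lin_dim d \<tau> + 1" "rays d \<tau> \<union> {\<rho>} = rays d \<sigma>"
    by (auto simp: nb_def cones_def)
  have "\<rho> \<notin> rays d \<tau>"
  proof
    assume "\<rho> \<in> rays d \<tau>"
    then have "rays d \<tau> = rays d \<sigma>" using \<sigma>(3) by auto
    then show False using card_rays[OF \<sigma>(1)] card_rays[OF assms] \<sigma>(2) by simp
  qed
  with \<sigma> show "\<rho> \<notin> rays d \<tau> \<and> (\<exists>\<sigma>\<in>\<Sigma>. rays d \<sigma> = insert \<rho> (rays d \<tau>))" by auto
next
  assume "\<rho> \<notin> rays d \<tau> \<and> (\<exists>\<sigma>\<in>\<Sigma>. rays d \<sigma> = insert \<rho> (rays d \<tau>))"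
  then obtain \<sigma> where \<sigma>: "\<rho> \<notin> rays d \<tau>" "\<sigma> \<in> \<Sigma>" "rays d \<sigma> = insert \<rho> (rays d \<tau>)" by blast
  then have "lin_dim d \<sigma> = lin_dim d \<tau> + 1"
    using card_rays[OF \<sigma>(2)] card_rays[OF assms] finite_rays[OF assms] by simp
  moreover have "\<rho> \<in> cones d \<Sigma> 1" using rays_subset[OF \<sigma>(2)] \<sigma>(3) by auto
  ultimately show "\<rho> \<in> nb d \<Sigma> \<tau>" using \<sigma> by (auto simp: nb_def cones_def)
qed

lemma nb_subset: "nb d \<Sigma> \<tau> \<subseteq> cones d \<Sigma> 1"
  by (auto simp: nb_def)

text \<open>The face of \<sigma> spanned by \<tau> and one further ray is the cone that makes this
  ray a neighbour.\<close>

lemma rays_diff_subset_nb: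
  assumes "\<tau> \<in> \<Sigma>" "\<sigma> \<in> \<Sigma>" "rays d \<tau> \<subseteq> rays d \<sigma>"
  shows "rays d \<sigma> - rays d \<tau> \<subseteq> nb d \<Sigma> \<tau>"
proof
  fix \<rho> assume \<rho>: "\<rho> \<in> rays d \<sigma> - rays d \<tau>"
  let ?J = "insert \<rho> (rays d \<tau>)"
  have "?J \<subseteq> rays d \<sigma>" using \<rho> assms by auto
  then have "family_cone d gen ?J \<in> \<Sigma>" "rays d (family_cone d gen ?J) = ?J"
    by (rule subcone_in_fan[OF assms(2)], rule rays_subcone[OF assms(2)])
  then show "\<rho> \<in> nb d \<Sigma> \<tau>" using \<rho> nb_iff[OF assms(1)] by blast
qed

section \<open>Row indices and the dimension of the coordinate subspace\<close>

lemma rs_row_ids: "R \<subseteq> cones d \<Sigma> 1 \<Longrightarrow> bij_betw ((!) rs) (row_ids rs R) R"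
  using ray_nth unfolding bij_betw_def row_ids_def
  by (fastforce simp: inj_on_def nth_eq_iff_index_eq[OF distinct_rs] image_iff)

lemma row_ids_le: "row_ids rs R \<subseteq> {..<length rs}" "finite (row_ids rs R)"
  by (auto simp: row_ids_def)

text \<open>The underlying linear subspace is spanned by the unit vectors at \<open>?I\<close>, the
  positions of the rays outside \<tau>.\<close>

lemma proj_lin_subspace_Lambda:
  assumes "\<tau> \<in> \<Sigma>"
  shows "proj_lin_subspace (length rs) (int (length rs) - int (lin_dim d \<tau>) - 1) (Lambda d rs \<tau>)"
proof -
  let ?n = "length rs"
  let ?W = "{x \<in> carrier_vec ?n. \<forall>i<?n. rs ! i \<in> rays d \<tau> \<longrightarrow> x $ i = (0 :: complex)}"
  let ?I = "{..<?n} - row_ids rs (rays d \<tau>)"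
  interpret vec_space "TYPE(complex)" ?n .
  have "submodule class_ring ?W V"
    by unfold_locales auto
  then have sub: "VectorSpace.subspace class_ring ?W V"
    using vec_vs by (simp add: VectorSpace.subspace_def)
  have W: "?W = {x \<in> carrier_vec ?n. \<forall>i<?n. i \<notin> ?I \<longrightarrow> x $ i = 0}"
    by (auto simp: row_ids_def)
  have "card (row_ids rs (rays d \<tau>)) = lin_dim d \<tau>"
    using bij_betw_same_card[OF rs_row_ids[OF rays_subset[OF assms]]] card_rays[OF assms] by simp
  \<comment> \<open>The bound on the number of rays of \<tau> makes the natural subtraction agree
    with the one of integers.\<close>
  then have "int (card ?I) = int ?n - int (lin_dim d \<tau>)"
    using card_Diff_subset[OF row_ids_le(2) row_ids_le(1), of "rays d \<tau>"]
      card_mono[OF _ row_ids_le(1), of "rays d \<tau>"] by simp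
  then have "int (lin_dim ?n ?W) - 1 = int ?n - int (lin_dim d \<tau>) - 1"
    unfolding W by (subst lin_dim_coordinate_subspace) auto
  moreover have "Lambda d rs \<tau> = proj_point ` (?W - {0\<^sub>v ?n})"
    unfolding Lambda_def by (intro image_cong) auto
  ultimately show ?thesis
    unfolding proj_lin_subspace_def using sub by blast
qed

end

section \<open>The star of a cone\<close>

locale star_of_cone = rayed_fan +
  fixes \<tau> :: "real vec set" and T :: "real mat"
  assumes tau_in_fan: "\<tau> \<in> \<Sigma>" and adapted: "adapted_matrix d rs U \<tau> T"
begin

abbreviation "k \<equiv> lin_dim d \<tau>"

abbreviation "bar \<equiv> bar_cone d \<tau> T"

definition coords :: "real vec \<Rightarrow> real vec" where
  "coords x = transpose_mat T *\<^sub>v x"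

text \<open>The quotient map modulo the span of \<tau>, in the coordinates given by
  \<open>T\<close>; \<open>quot_coords_coset\<close> makes this precise.\<close>

definition proj :: "real vec \<Rightarrow> real vec" where
  "proj x = vec_last (coords x) (d - k)"

text \<open>For rays in \<open>nb d \<Sigma> \<tau>\<close> these are the rows of the star
  matrix.\<close>

abbreviation "pgen \<rho> \<equiv> proj (gen \<rho>)"

section \<open>The coordinates given by \<open>T\<close>\<close>

lemma T_carrier [simp]: "T \<in> carrier_mat d d" and T_invertible: "invertible_mat T"
  using adapted by (auto simp: adapted_matrix_def)

lemma dim_T [simp]: "dim_row T = d" "dim_col T = d"
  using carrier_matD[OF T_carrier] by simp_all

lemma det_T_nonzero: "det T \<noteq> 0"
proof -
  obtain B where B: "T * B = 1\<^sub>m d" "B * T = 1\<^sub>m (dim_row B)"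
    using T_invertible T_carrier by (auto simp: invertible_mat_def inverts_mat_def)
  \<comment> \<open>The definition of invertibility does not fix the shape of \<open>B\<close>, so
    it is read off from the two products.\<close>
  have "dim_col (B * T) = dim_row B" by (simp add: B)
  moreover have "dim_col (T * B) = d" by (simp add: B)
  ultimately have "B \<in> carrier_mat d d" using T_carrier by auto
  then have "det T * det B = 1" using det_mult[OF T_carrier, of B] B by simp
  then show ?thesis by auto
qed

lemma dim_coords [simp]: "dim_vec (coords x) = d"
  by (simp add: coords_def)

lemma coords_carrier [simp]: "coords x \<in> carrier_vec d"
  by (rule carrier_vecI) simp

lemma coords_index:
  "j < d \<Longrightarrow> coords x $ j = col T j \<bullet> x"
  by (simp add: coords_def)

lemma col_T_carrier: "col T j \<in> carrier_vec d"
  by (rule carrier_vecI) simp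

lemma coords_inj:
  assumes "x \<in> carrier_vec d" "y \<in> carrier_vec d" "coords x = coords y"
  shows "x = y"
proof -
  have tc: "transpose_mat T \<in> carrier_mat d d" by simp
  have "transpose_mat T *\<^sub>v (x - y) = 0\<^sub>v d"
    using assms mult_minus_distrib_mat_vec[OF tc assms(1,2)] coords_carrier[of y]
    by (simp add: coords_def)
  moreover have "det (transpose_mat T) \<noteq> 0" using det_T_nonzero det_transpose[OF T_carrier] by simp
  ultimately have "x - y = 0\<^sub>v d"
    using det_0_iff_vec_prod_zero_field[OF tc] assms(1,2) by (metis minus_carrier_vec)
  then have "x $ i - y $ i = 0" if "i < d" for i
    using that assms by (metis carrier_vecD index_minus_vec(1) index_zero_vec(1))
  then show ?thesis using assms by (intro eq_vecI) auto
qed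

lemma coords_gen:
  assumes "i < length rs"
  shows "coords (gen (rs ! i)) = row (U * T) i"
proof (rule eq_vecI)
  show "dim_vec (coords (gen (rs ! i))) = dim_vec (row (U * T) i)"
    by simp
  fix j assume "j < dim_vec (row (U * T) i)"
  then have j: "j < d" by simp
  have "row U i \<in> carrier_vec d" using U_carrier by auto
  then show "coords (gen (rs ! i)) $ j = row (U * T) i $ j"
    using assms j U_carrier col_T_carrier[of j]
    by (simp add: coords_index gen_nth comm_scalar_prod[of _ d])
qed

lemma k_le: "k \<le> d"
  using card_indep_family_le[OF indep_rays finite_rays gen_rays_carrier, OF tau_in_fan tau_in_fan tau_in_fan]
    card_rays[OF tau_in_fan] by simp

text \<open>\<open>adapted_matrix\<close> only equates two sets of vectors. As \<tau> has
  \<open>k\<close> rays and there are \<open>k\<close> distinct unit vectors, the resulting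
  surjection is a bijection, and its inverse numbers the rays of \<tau>.\<close>

lemma unit_rays_ex:
  "\<exists>p. bij_betw p {..<k} (rays d \<tau>) \<and> (\<forall>j<k. coords (gen (p j)) = unit_vec d j)"
proof -
  let ?h = "\<lambda>\<rho>. coords (gen \<rho>)"
  have "?h ` rays d \<tau> = {row (U * T) i | i. i \<in> row_ids rs (rays d \<tau>)}"
  proof -
    have "rays d \<tau> = (!) rs ` row_ids rs (rays d \<tau>)"
      using rs_row_ids[OF rays_subset[OF tau_in_fan]] by (simp add: bij_betw_def)
    then have "?h ` rays d \<tau> = (\<lambda>i. ?h (rs ! i)) ` row_ids rs (rays d \<tau>)"
      by (metis image_image)
    also have "\<dots> = (\<lambda>i. row (U * T) i) ` row_ids rs (rays d \<tau>)"
      by (intro image_cong) (auto simp: row_ids_def coords_gen)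
    finally show ?thesis by blast
  qed
  also have "\<dots> = unit_vec d ` {..<k}"
    using adapted by (auto simp: adapted_matrix_def)
  finally have im: "?h ` rays d \<tau> = unit_vec d ` {..<k}" .
  have inj_unit: "inj_on (unit_vec d :: nat \<Rightarrow> real vec) {..<k}"
  proof (rule inj_onI)
    fix i j assume ij: "i \<in> {..<k}" "j \<in> {..<k}" "(unit_vec d i :: real vec) = unit_vec d j"
    then have "(unit_vec d i :: real vec) $ i = unit_vec d j $ i" by simp
    then show "i = j" using ij k_le by (simp split: if_splits)
  qed
  have "card (?h ` rays d \<tau>) = card (rays d \<tau>)"
    unfolding im using card_image[OF inj_unit] card_rays[OF tau_in_fan] by simp
  then have h: "bij_betw ?h (rays d \<tau>) (unit_vec d ` {..<k})"
    using finite_rays[OF tau_in_fan] im by (auto simp: bij_betw_def eq_card_imp_inj_on)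
  have "bij_betw (inv_into (rays d \<tau>) ?h \<circ> unit_vec d) {..<k} (rays d \<tau>)"
    using inj_unit by (intro bij_betw_trans[OF _ bij_betw_inv_into[OF h]]) (simp add: bij_betw_def)
  moreover have "coords (gen ((inv_into (rays d \<tau>) ?h \<circ> unit_vec d) j)) = unit_vec d j" if "j < k" for j
    using that im f_inv_into_f[of "unit_vec d j" ?h "rays d \<tau>"] by auto
  ultimately show ?thesis by blast
qed

definition unit_ray :: "nat \<Rightarrow> real vec set" where
  "unit_ray = (SOME p. bij_betw p {..<k} (rays d \<tau>) \<and> (\<forall>j<k. coords (gen (p j)) = unit_vec d j))"

lemma unit_ray_bij: "bij_betw unit_ray {..<k} (rays d \<tau>)"
  and coords_unit_ray: "j < k \<Longrightarrow> coords (gen (unit_ray j)) = unit_vec d j"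
  using someI_ex[OF unit_rays_ex] unfolding unit_ray_def by blast+

section \<open>The projection modulo the span of \<tau>\<close>

lemma proj_carrier [simp]: "proj x \<in> carrier_vec (d - k)"
  by (simp add: proj_def)

lemma dim_proj [simp]: "dim_vec (proj x) = d - k"
  by (simp add: proj_def)

lemma proj_index: "j < d - k \<Longrightarrow> proj x $ j = coords x $ (k + j)"
  using k_le by (simp add: proj_def vec_last_def)

lemma coords_vcomb:
  assumes "u ` I \<subseteq> carrier_vec d"
  shows "coords (vcomb d u c I) = vcomb d (\<lambda>\<rho>. coords (u \<rho>)) c I"
proof (rule eq_vecI)
  show "dim_vec (coords (vcomb d u c I)) = dim_vec (vcomb d (\<lambda>\<rho>. coords (u \<rho>)) c I)"
    by simp
  fix j assume "j < dim_vec (vcomb d (\<lambda>\<rho>. coords (u \<rho>)) c I)"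
  then show "coords (vcomb d u c I) $ j = vcomb d (\<lambda>\<rho>. coords (u \<rho>)) c I $ j"
    using scalar_prod_vcomb[OF col_T_carrier assms]
    by (simp add: coords_index) (simp add: vcomb_def coords_index)
qed

lemma proj_vcomb:
  assumes "u ` I \<subseteq> carrier_vec d"
  shows "proj (vcomb d u c I) = vcomb (d - k) (\<lambda>\<rho>. proj (u \<rho>)) c I"
  by (rule eq_vecI)
    (use k_le in \<open>simp_all add: proj_index coords_vcomb[OF assms], simp add: vcomb_def proj_index\<close>)

lemma proj_add:
  assumes "x \<in> carrier_vec d" "y \<in> carrier_vec d"
  shows "proj (x + y) = proj x + proj y"
  by (rule eq_vecI)
    (use assms in \<open>auto simp: proj_index coords_index scalar_prod_add_distrib[OF col_T_carrier]\<close>)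

lemma proj_smult:
  assumes "x \<in> carrier_vec d"
  shows "proj (a \<cdot>\<^sub>v x) = a \<cdot>\<^sub>v proj x"
  by (rule eq_vecI)
    (use assms in \<open>auto simp: proj_index coords_index\<close>)

lemma pgen_tau:
  assumes "\<rho> \<in> rays d \<tau>"
  shows "pgen \<rho> = 0\<^sub>v (d - k)"
proof -
  obtain j where j: "j < k" "\<rho> = unit_ray j"
    using assms unit_ray_bij by (auto simp: bij_betw_def)
  show ?thesis
    by (rule eq_vecI) (use j in \<open>auto simp: proj_index coords_unit_ray\<close>)
qed

text \<open>Only the first \<open>k\<close> coordinates of \<open>x\<close> can be nonzero, and the
  first \<open>k\<close> unit vectors are the coordinates of the rows of \<tau>. So the coefficient
  at \<open>unit_ray i\<close> is coordinate \<open>i\<close> of \<open>x\<close>.\<close>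

lemma proj_kernel:
  assumes "x \<in> carrier_vec d" "proj x = 0\<^sub>v (d - k)"
  shows "\<exists>c. x = vcomb d gen c (rays d \<tau>)"
proof -
  define c where "c \<rho> = coords x $ (inv_into {..<k} unit_ray \<rho>)" for \<rho>
  have c: "c (unit_ray i) = coords x $ i" if "i < k" for i
    using that unit_ray_bij unfolding c_def by (simp add: bij_betw_def inv_into_f_f)
  have "coords (vcomb d gen c (rays d \<tau>)) $ j = coords x $ j" if j: "j < d" for j
  proof -
    have "coords (vcomb d gen c (rays d \<tau>)) $ j = (\<Sum>\<rho>\<in>rays d \<tau>. c \<rho> * coords (gen \<rho>) $ j)"
      using coords_vcomb[OF gen_rays_carrier[OF tau_in_fan]] j by (simp add: vcomb_def)
    also have "\<dots> = (\<Sum>i<k. c (unit_ray i) * coords (gen (unit_ray i)) $ j)"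
      by (rule sum.reindex_bij_betw[OF unit_ray_bij, symmetric])
    also have "\<dots> = (\<Sum>i<k. if i = j then coords x $ i else 0)"
      using j k_le by (intro sum.cong) (auto simp: c coords_unit_ray)
    also have "\<dots> = coords x $ j"
    proof (cases "j < k")
      case False
      then have "coords x $ j = proj x $ (j - k)" using j by (simp add: proj_index)
      then show ?thesis using False j assms(2) by simp
    qed simp
    finally show ?thesis .
  qed
  then have "coords x = coords (vcomb d gen c (rays d \<tau>))"
    by (intro eq_vecI) simp_all
  then show ?thesis using coords_inj[OF assms(1) vcomb_carrier] by blast
qed

text \<open>By \<open>proj_kernel\<close> a relation among the projections lifts to an equality
  between a combination over \<sigma>(1) - \<tau>(1) and one over \<tau>(1). Independence of the
  rows of \<sigma> kills the coefficients.\<close>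

lemma indep_pgen:
  assumes "\<sigma> \<in> \<Sigma>" "rays d \<tau> \<subseteq> rays d \<sigma>"
  shows "indep_family (d - k) pgen (rays d \<sigma> - rays d \<tau>)"
  unfolding indep_family_def
proof (intro allI impI ballI)
  fix c \<rho>
  let ?D = "rays d \<sigma> - rays d \<tau>"
  assume 0: "vcomb (d - k) pgen c ?D = 0\<^sub>v (d - k)" and \<rho>: "\<rho> \<in> ?D"
  have "gen ` ?D \<subseteq> carrier_vec d" using gen_rays_carrier[OF assms(1)] by auto
  then have "proj (vcomb d gen c ?D) = 0\<^sub>v (d - k)" by (simp add: proj_vcomb 0)
  then obtain b where "vcomb d gen c ?D = vcomb d gen b (rays d \<tau>)"
    using proj_kernel[OF vcomb_carrier] by blast
  then have "vcomb d gen (\<lambda>i. if i \<in> ?D then c i else 0) (rays d \<sigma>) =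
      vcomb d gen (\<lambda>i. if i \<in> rays d \<tau> then b i else 0) (rays d \<sigma>)"
    using vcomb_superset[OF finite_rays[OF assms(1)], of ?D d gen c]
      vcomb_superset[OF finite_rays[OF assms(1)] assms(2), of d gen b] by simp
  from vcomb_eqD[OF indep_rays[OF assms(1)] this, of \<rho>] \<rho> show "c \<rho> = 0" by simp
qed

section \<open>Identification of the quotient with coordinate space\<close>

lemma tau_carrier: "\<tau> \<subseteq> carrier_vec d"
  using cone_eq[OF tau_in_fan] family_cone_carrier by metis

text \<open>The kernel of \<open>proj\<close> is a submodule containing \<tau>, hence its span. So
  \<open>proj\<close> is constant on cosets.\<close>

lemma proj_vspan:
  assumes "x \<in> vspan d \<tau>"
  shows "x \<in> carrier_vec d \<and> proj x = 0\<^sub>v (d - k)"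
proof -
  interpret vec_space "TYPE(real)" d .
  let ?N = "{x \<in> carrier_vec d. proj x = 0\<^sub>v (d - k)}"
  have zero: "proj (0\<^sub>v d) = 0\<^sub>v (d - k)"
    by (rule eq_vecI) (auto simp: proj_index coords_index scalar_prod_right_zero[OF col_T_carrier])
  have "submodule class_ring ?N V"
    using zero
    by unfold_locales (auto simp: proj_add proj_smult)
  moreover have "\<tau> \<subseteq> ?N"
  proof
    fix x assume "x \<in> \<tau>"
    then have "x \<in> family_cone d gen (rays d \<tau>)" by (simp add: cone_eq[OF tau_in_fan])
    then obtain c where x: "x = vcomb d gen c (rays d \<tau>)" by (auto simp: family_cone_def)
    have "proj x = vcomb (d - k) pgen c (rays d \<tau>)"
      unfolding x by (rule proj_vcomb[OF gen_rays_carrier[OF tau_in_fan]])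
    also have "\<dots> = vcomb (d - k) pgen c {}"
      by (rule vcomb_vanish_superset[OF finite_rays[OF tau_in_fan]]) (auto simp: pgen_tau)
    also have "\<dots> = 0\<^sub>v (d - k)" by (rule eq_vecI) (auto simp: vcomb_def)
    finally show "x \<in> ?N" by (simp add: x)
  qed
  ultimately show ?thesis using span_is_subset[of \<tau> ?N] assms by blast
qed

lemma zero_in_vspan: "0\<^sub>v d \<in> vspan d \<tau>"
proof -
  interpret vec_space "TYPE(real)" d .
  note span_is_submodule[OF tau_carrier]
  from submodule.zero_closed[OF this] show ?thesis by simp
qed

lemma quot_coords_coset:
  assumes "x \<in> carrier_vec d"
  shows "quot_coords d \<tau> T (coset_mod d \<tau> x) = proj x"
  unfolding quot_coords_def
proof (rule the_equality)
  have proj_eq: "vec_last (transpose_mat T *\<^sub>v y) (d - k) = proj y" for y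
    by (simp add: proj_def coords_def)
  show "\<forall>y\<in>coset_mod d \<tau> x. proj x = vec_last (transpose_mat T *\<^sub>v y) (d - k)"
    unfolding proj_eq using proj_vspan
    by (auto simp: coset_mod_def proj_add[OF assms])
  fix y assume y: "\<forall>z\<in>coset_mod d \<tau> x. y = vec_last (transpose_mat T *\<^sub>v z) (d - k)"
  \<comment> \<open>The coset is nonempty, which makes the described value unique.\<close>
  have "x \<in> coset_mod d \<tau> x"
    unfolding coset_mod_def using zero_in_vspan assms by force
  then show "y = proj x" using y unfolding proj_eq by blast
qed

lemma bar_eq_image:
  assumes "\<sigma> \<subseteq> carrier_vec d"
  shows "bar \<sigma> = proj ` \<sigma>"
  unfolding bar_cone_def image_image
  using assms by (intro image_cong) (auto simp: quot_coords_coset)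

lemma bar_family_cone:
  assumes "gen ` I \<subseteq> carrier_vec d"
  shows "bar (family_cone d gen I) = family_cone (d - k) pgen I"
  unfolding bar_eq_image[OF family_cone_carrier]
  by (force simp: family_cone_def simp flip: proj_vcomb[OF assms])

lemma bar_ray: "\<rho> \<in> cones d \<Sigma> 1 \<Longrightarrow> bar \<rho> = family_cone (d - k) pgen {\<rho>}"
  using bar_family_cone[of "{\<rho>}"] ray_eq[of \<rho>] gen_carrier[of \<rho>] by simp

lemma bar_cone_eq:
  assumes "\<sigma> \<in> \<Sigma>" "rays d \<tau> \<subseteq> rays d \<sigma>"
  shows "bar \<sigma> = family_cone (d - k) pgen (rays d \<sigma> - rays d \<tau>)"
proof -
  have "bar \<sigma> = family_cone (d - k) pgen (rays d \<sigma>)"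
    using bar_family_cone[OF gen_rays_carrier[OF assms(1)]] cone_eq[OF assms(1)] by simp
  also have "\<dots> = family_cone (d - k) pgen (rays d \<sigma> - rays d \<tau>)"
    by (rule family_cone_vanish_superset[OF finite_rays[OF assms(1)]]) (auto simp: pgen_tau)
  finally show ?thesis .
qed

section \<open>Cones and rays of the star fan\<close>

text \<open>By \<open>face_iff\<close> these are the cones of the fan with \<tau> as a face.\<close>

definition star :: "real vec set set" where
  "star = {\<sigma> \<in> \<Sigma>. rays d \<tau> \<subseteq> rays d \<sigma>}"

lemma star_fan_coords_eq: "star_fan_coords d \<Sigma> \<tau> T = bar ` star"
  unfolding star_fan_coords_def star_fan_def star_def bar_cone_def
  using face_iff[OF tau_in_fan] by (auto simp: image_iff)

lemma pgen_carrier: "pgen ` I \<subseteq> carrier_vec (d - k)"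
  by auto

lemma rays_bar:
  assumes "\<sigma> \<in> star"
  shows "rays (d - k) (bar \<sigma>) = bar ` (rays d \<sigma> - rays d \<tau>)"
proof -
  have \<sigma>: "\<sigma> \<in> \<Sigma>" "rays d \<tau> \<subseteq> rays d \<sigma>" using assms by (auto simp: star_def)
  have "rays (d - k) (bar \<sigma>) = (\<lambda>\<rho>. family_cone (d - k) pgen {\<rho>}) ` (rays d \<sigma> - rays d \<tau>)"
    unfolding bar_cone_eq[OF \<sigma>]
    by (rule rays_family_cone[OF indep_pgen[OF \<sigma>] _ pgen_carrier]) (simp add: finite_rays[OF \<sigma>(1)])
  also have "\<dots> = bar ` (rays d \<sigma> - rays d \<tau>)"
    using rays_subset[OF \<sigma>(1)] by (intro image_cong) (auto simp: bar_ray)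
  finally show ?thesis .
qed

lemma card_rays_diff:
  assumes "\<sigma> \<in> star"
  shows "card (rays d \<sigma> - rays d \<tau>) = lin_dim d \<sigma> - k" and "k \<le> lin_dim d \<sigma>"
  using assms card_rays[OF tau_in_fan] card_rays[of \<sigma>] finite_rays[OF tau_in_fan] finite_rays[of \<sigma>]
  by (auto simp: star_def card_Diff_subset) (metis card_mono)

lemma lin_dim_bar:
  assumes "\<sigma> \<in> star"
  shows "lin_dim (d - k) (bar \<sigma>) = lin_dim d \<sigma> - k"
proof -
  have \<sigma>: "\<sigma> \<in> \<Sigma>" "rays d \<tau> \<subseteq> rays d \<sigma>" using assms by (auto simp: star_def)
  have "lin_dim (d - k) (bar \<sigma>) = card (rays d \<sigma> - rays d \<tau>)"
    unfolding bar_cone_eq[OF \<sigma>]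
    by (rule lin_dim_family_cone[OF indep_pgen[OF \<sigma>] _ pgen_carrier]) (simp add: finite_rays[OF \<sigma>(1)])
  then show ?thesis using card_rays_diff[OF assms] by simp
qed

text \<open>If \<open>\<rho>\<close> and \<open>\<rho>'\<close> have the same image, then collecting the coefficients of \<open>gen \<rho> - a gen \<rho>'\<close>
  along \<open>\<tau>\<close> by sign gives a point of both cones \<open>\<tau> + \<rho>\<close> and \<open>\<tau> + \<rho>'\<close> with a positive coefficient
  at \<open>\<rho>\<close>, so the common face contains \<open>\<rho>\<close>.\<close>

lemma inj_on_bar_nb: "inj_on bar (nb d \<Sigma> \<tau>)"
proof (rule inj_onI)
  fix \<rho> \<rho>' assume nb: "\<rho> \<in> nb d \<Sigma> \<tau>" "\<rho>' \<in> nb d \<Sigma> \<tau>" and eq: "bar \<rho> = bar \<rho>'"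
  let ?R = "rays d \<tau>"
  obtain \<sigma> where \<sigma>: "\<sigma> \<in> \<Sigma>" "rays d \<sigma> = insert \<rho> ?R" "\<rho> \<notin> ?R"
    using nb nb_iff[OF tau_in_fan] by blast
  obtain \<sigma>' where \<sigma>': "\<sigma>' \<in> \<Sigma>" "rays d \<sigma>' = insert \<rho>' ?R" "\<rho>' \<notin> ?R"
    using nb nb_iff[OF tau_in_fan] by blast
  have cone1: "\<rho> \<in> cones d \<Sigma> 1" "\<rho>' \<in> cones d \<Sigma> 1" using nb nb_subset by blast+
  have "pgen \<rho> \<in> family_cone (d - k) pgen {\<rho>}"
    by (rule generator_in_family_cone) auto
  then have "pgen \<rho> \<in> family_cone (d - k) pgen {\<rho>'}"
    using eq bar_ray cone1 by simp
  then obtain a where a: "0 \<le> a" "pgen \<rho> = a \<cdot>\<^sub>v pgen \<rho>'"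
    using vcomb_singleton[of pgen \<rho>' "d - k"] by (auto simp: family_cone_def)
  note car = gen_carrier[OF cone1(1)] gen_carrier[OF cone1(2)]
  let ?x = "gen \<rho> + (- a) \<cdot>\<^sub>v gen \<rho>'"
  have "proj ?x = 0\<^sub>v (d - k)"
    using car a(2) by (simp add: proj_add proj_smult) (rule eq_vecI, auto)
  then obtain c where c: "?x = vcomb d gen c ?R"
    using proj_kernel[of ?x] car by auto
  \<comment> \<open>Since neither \<rho> nor \<open>\<rho>'\<close> is a ray of \<tau>,
    \<open>c2 \<eta> - c1 \<eta> = c \<eta>\<close> holds on the rays of \<tau>, while both
    functions are nonnegative.\<close>
  define c1 where "c1 \<eta> = (if \<eta> = \<rho> then 1 else max 0 (- c \<eta>))" for \<eta>
  define c2 where "c2 \<eta> = (if \<eta> = \<rho>' then a else max 0 (c \<eta>))" for \<eta>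
  have p: "vcomb d gen c1 (rays d \<sigma>) = vcomb d gen c2 (rays d \<sigma>')"
  proof (rule eq_vecI)
    fix j assume "j < dim_vec (vcomb d gen c2 (rays d \<sigma>'))"
    then have j: "j < d" by simp
    have "?x $ j = vcomb d gen c ?R $ j" by (simp only: c)
    then have "gen \<rho> $ j - a * gen \<rho>' $ j = (\<Sum>\<eta>\<in>?R. c \<eta> * gen \<eta> $ j)"
      using j car by (simp add: vcomb_def)
    also have "\<dots> = (\<Sum>\<eta>\<in>?R. c2 \<eta> * gen \<eta> $ j) - (\<Sum>\<eta>\<in>?R. c1 \<eta> * gen \<eta> $ j)"
      unfolding sum_subtractf[symmetric]
      using \<sigma>(3) \<sigma>'(3)
      by (intro sum.cong) (auto simp: c1_def c2_def max_def simp flip: left_diff_distrib)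
    finally show "vcomb d gen c1 (rays d \<sigma>) $ j = vcomb d gen c2 (rays d \<sigma>') $ j"
      using j \<sigma> \<sigma>' finite_rays[OF tau_in_fan]
      by (simp add: vcomb_def) (simp add: c1_def c2_def)
  qed simp
  let ?p = "vcomb d gen c1 (rays d \<sigma>)"
  have "?p \<in> family_cone d gen (rays d \<sigma>)"
    unfolding family_cone_def by (auto simp: c1_def)
  moreover have "?p \<in> family_cone d gen (rays d \<sigma>')"
    unfolding family_cone_def p using a(1) by (auto simp: c2_def)
  ultimately have p_in: "?p \<in> \<sigma> \<inter> \<sigma>'" using cone_eq \<sigma>(1) \<sigma>'(1) by simp
  let ?J = "rays d (\<sigma> \<inter> \<sigma>')"
  have face: "cone_face d (\<sigma> \<inter> \<sigma>') \<sigma>" "cone_face d (\<sigma> \<inter> \<sigma>') \<sigma>'"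
    using inter_face[OF \<sigma>(1) \<sigma>'(1)] inter_face[OF \<sigma>'(1) \<sigma>(1)] by (simp_all add: Int_commute)
  have inter: "\<sigma> \<inter> \<sigma>' \<in> \<Sigma>" by (rule face_in_fan[OF \<sigma>(1) face(1)])
  have J: "?J \<subseteq> rays d \<sigma>" "?J \<subseteq> rays d \<sigma>'"
    using face face_iff[OF inter] \<sigma>(1) \<sigma>'(1) by auto
  obtain b where "?p = vcomb d gen b ?J"
    using p_in cone_eq[OF inter] unfolding family_cone_def by auto
  then have "?p = vcomb d gen (\<lambda>i. if i \<in> ?J then b i else 0) (rays d \<sigma>)"
    using vcomb_superset[OF finite_rays[OF \<sigma>(1)] J(1)] by simp
  from vcomb_eqD[OF indep_rays[OF \<sigma>(1)] this, of \<rho>] have "\<rho> \<in> ?J"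
    using \<sigma>(2) by (simp add: c1_def split: if_splits)
  then show "\<rho> = \<rho>'" using J(2) \<sigma>'(2) \<sigma>(3) by auto
qed

lemma rays_diff_nb: "\<sigma> \<in> star \<Longrightarrow> rays d \<sigma> - rays d \<tau> \<subseteq> nb d \<Sigma> \<tau>"
  using rays_diff_subset_nb[OF tau_in_fan] by (simp add: star_def)

text \<open>The image cone determines its rays, and injectivity on the neighbours recovers the rays
  of \<sigma> outside \<tau> from them.\<close>

lemma inj_on_bar_star: "inj_on bar star"
proof (rule inj_onI)
  fix \<sigma> \<sigma>' assume \<sigma>: "\<sigma> \<in> star" "\<sigma>' \<in> star" and "bar \<sigma> = bar \<sigma>'"
  then have "bar ` (rays d \<sigma> - rays d \<tau>) = bar ` (rays d \<sigma>' - rays d \<tau>)"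
    using rays_bar by metis
  then have "rays d \<sigma> - rays d \<tau> = rays d \<sigma>' - rays d \<tau>"
    using inj_on_image_eq_iff[OF inj_on_bar_nb] rays_diff_nb \<sigma> by metis
  then have "rays d \<sigma> = rays d \<sigma>'" using \<sigma> unfolding star_def by blast
  then show "\<sigma> = \<sigma>'" using \<sigma> cone_eq_iff by (auto simp: star_def)
qed

text \<open>The image of a cone of the star is one-dimensional exactly when the cone has one ray
  more than \<tau>; it is then the image of that ray, which is a neighbour.\<close>

lemma cones_star_1: "cones (d - k) (star_fan_coords d \<Sigma> \<tau> T) 1 = bar ` nb d \<Sigma> \<tau>"
proof (intro equalityI subsetI)
  fix K assume "K \<in> cones (d - k) (star_fan_coords d \<Sigma> \<tau> T) 1"
  then obtain \<sigma> where \<sigma>: "\<sigma> \<in> star" "K = bar \<sigma>" "lin_dim d \<sigma> - k = 1"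
    using lin_dim_bar by (auto simp: cones_def star_fan_coords_eq)
  then obtain \<rho> where \<rho>: "rays d \<sigma> - rays d \<tau> = {\<rho>}"
    using card_rays_diff(1) by (metis card_1_singletonE)
  then have "\<rho> \<in> nb d \<Sigma> \<tau>" using rays_diff_nb[OF \<sigma>(1)] by auto
  moreover have "K = bar \<rho>"
    using \<sigma> \<rho> bar_cone_eq[of \<sigma>] bar_ray[OF subsetD[OF nb_subset calculation]]
    by (simp add: star_def)
  ultimately show "K \<in> bar ` nb d \<Sigma> \<tau>" by blast
next
  fix K assume "K \<in> bar ` nb d \<Sigma> \<tau>"
  then obtain \<rho> where \<rho>: "\<rho> \<in> nb d \<Sigma> \<tau>" "K = bar \<rho>" by blast
  then obtain \<sigma> where \<sigma>: "\<sigma> \<in> \<Sigma>" "rays d \<sigma> = insert \<rho> (rays d \<tau>)" "\<rho> \<notin> rays d \<tau>"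
    using nb_iff[OF tau_in_fan] by blast
  then have star: "\<sigma> \<in> star" and diff: "rays d \<sigma> - rays d \<tau> = {\<rho>}" by (auto simp: star_def)
  have "K = bar \<sigma>"
    using \<rho>(2) diff bar_cone_eq[of \<sigma>] bar_ray[OF subsetD[OF nb_subset \<rho>(1)]] star
    by (simp add: star_def)
  moreover have "lin_dim (d - k) (bar \<sigma>) = 1"
    using lin_dim_bar[OF star] card_rays_diff(1)[OF star] diff by simp
  ultimately show "K \<in> cones (d - k) (star_fan_coords d \<Sigma> \<tau> T) 1"
    using star by (auto simp: cones_def star_fan_coords_eq)
qed

lemma lin_dim_le: "\<sigma> \<in> \<Sigma> \<Longrightarrow> lin_dim d \<sigma> \<le> d"
  using card_indep_family_le[OF indep_rays finite_rays gen_rays_carrier] card_rays by metis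

lemma cones_star_max:
  "cones (d - k) (star_fan_coords d \<Sigma> \<tau> T) (d - k) = bar ` {\<sigma> \<in> star. lin_dim d \<sigma> = d}"
proof -
  \<comment> \<open>Subtraction is truncated here, so the bounds by \<open>k\<close> from below and
    by \<open>d\<close> from above are both used.\<close>
  have "lin_dim (d - k) (bar \<sigma>) = d - k \<longleftrightarrow> lin_dim d \<sigma> = d" if "\<sigma> \<in> star" for \<sigma>
    using lin_dim_bar[OF that] card_rays_diff(2)[OF that] lin_dim_le[of \<sigma>] k_le that
    by (auto simp: star_def)
  then show ?thesis by (auto simp: cones_def star_fan_coords_eq)
qed

end

section \<open>Comparison of the adjoints\<close>

context star_of_cone
begin

section \<open>Determinants of the maximal cones\<close>

lemma UT_index:
  assumes "i < length rs" "j < d"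
  shows "(U * T) $$ (i, j) = coords (gen (rs ! i)) $ j"
  using assms U_carrier by (simp add: coords_gen)

text \<open>Selecting rows commutes with multiplication by \<open>T\<close> from the right, and the
  selection is square because \<sigma> has \<open>d\<close> rays.\<close>

lemma det_submatrix_UT:
  assumes "\<sigma> \<in> \<Sigma>" "lin_dim d \<sigma> = d"
  shows "det (submatrix (U * T) (row_ids rs (rays d \<sigma>)) UNIV) =
    det (submatrix U (row_ids rs (rays d \<sigma>)) UNIV) * det T"
proof -
  let ?I = "row_ids rs (rays d \<sigma>)"
  have bij: "bij_betw ((!) rs) ?I (rays d \<sigma>)" by (rule rs_row_ids[OF rays_subset[OF assms(1)]])
  have card: "card ?I = d" using bij_betw_same_card[OF bij] card_rays assms by simp
  have pick: "pick ?I i < length rs" if "i < d" for i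
    using pick_bij_betw[OF row_ids_le(2), of "rays d \<sigma>"] row_ids_le(1)[of "rays d \<sigma>"] that card
    by (auto simp: bij_betw_def)
  have U: "submatrix U ?I UNIV = mat d d (\<lambda>(i, j). U $$ (pick ?I i, j))"
    using submatrix_UNIV_cols[of ?I U] row_ids_le(1) U_carrier card by auto
  have UT: "submatrix (U * T) ?I UNIV = mat d d (\<lambda>(i, j). (U * T) $$ (pick ?I i, j))"
    using submatrix_UNIV_cols[of ?I "U * T"] row_ids_le(1) U_carrier card by auto
  have "submatrix (U * T) ?I UNIV = submatrix U ?I UNIV * T"
  proof (rule eq_matI)
    fix i j assume "i < dim_row (submatrix U ?I UNIV * T)" "j < dim_col (submatrix U ?I UNIV * T)"
    then have ij: "i < d" "j < d" by (auto simp: U)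
    have "row (submatrix U ?I UNIV) i = row U (pick ?I i)"
      unfolding U by (rule eq_vecI) (use ij pick U_carrier in auto)
    then show "submatrix (U * T) ?I UNIV $$ (i, j) = (submatrix U ?I UNIV * T) $$ (i, j)"
      using ij pick[of i] U_carrier by (simp add: UT) (simp add: U)
  qed (auto simp: U UT)
  then show ?thesis using det_mult[of "submatrix U ?I UNIV" d T] by (simp add: U)
qed

text \<open>Two numberings meet: rows of \<open>U\<close> follow \<open>rs\<close>, rows of the star
  matrix follow the list of neighbours. Both submatrices are rewritten as enumerations of rays of
  \<sigma>, by \<open>?f\<close> and \<open>?g\<close>, to which \<open>abs_det_unit_rows\<close>
  applies with \<open>unit_ray\<close> listing the unit rows.\<close>

lemma abs_det_star:
  assumes "\<sigma> \<in> star" "lin_dim d \<sigma> = d"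
  shows "\<bar>det (submatrix (star_matrix d \<Sigma> rs U \<tau> T)
      (row_ids (star_rays d \<Sigma> rs \<tau> T) (rays (d - k) (bar \<sigma>))) UNIV)\<bar> =
    \<bar>det (submatrix U (row_ids rs (rays d \<sigma>)) UNIV)\<bar> * \<bar>det T\<bar>"
proof -
  have \<sigma>: "\<sigma> \<in> \<Sigma>" "rays d \<tau> \<subseteq> rays d \<sigma>" using assms(1) by (auto simp: star_def)
  let ?I = "row_ids rs (rays d \<sigma>)"
  let ?D = "rays d \<sigma> - rays d \<tau>"
  let ?R = "\<lambda>\<rho> j. coords (gen \<rho>) $ j"
  let ?nb = "nb d \<Sigma> \<tau>"
  let ?N = "row_ids rs ?nb"
  let ?fs = "filter (\<lambda>\<rho>. \<rho> \<in> ?nb) rs"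
  let ?I' = "row_ids (star_rays d \<Sigma> rs \<tau> T) (rays (d - k) (bar \<sigma>))"
  let ?g = "\<lambda>i. ?fs ! pick ?I' i"
  have cardD: "card ?D = d - k" using card_rays_diff(1)[OF assms(1)] assms(2) by simp
  \<comment> \<open>As \<open>nths\<close>, the filtered list has the order of
    \<open>pick ?N\<close>, by which the star matrix selects its rows.\<close>
  have fs_nths: "?fs = nths rs ?N"
    by (simp add: filter_eq_nths row_ids_def)
  have N_eq: "{i. i < length rs \<and> i \<in> ?N} = ?N" by (auto simp: row_ids_def)
  have len_fs: "length ?fs = card ?N"
    unfolding fs_nths length_nths N_eq ..
  have fs_nth: "?fs ! i = rs ! pick ?N i" if "i < card ?N" for i
    unfolding fs_nths using that by (intro nth_nths) (simp add: N_eq)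
  have pick_N: "pick ?N i < length rs" if "i < card ?N" for i
    using pick_in_set_le[OF that] by (simp add: row_ids_def)
  have set_fs: "set ?fs = ?nb" using nb_subset set_rs by auto
  have D_nb: "?D \<subseteq> ?nb" by (rule rays_diff_nb[OF assms(1)])
  \<comment> \<open>Rows of the star matrix are labelled by image rays; injectivity of
    \<open>bar\<close> on the neighbours turns membership among the rays of
    \<open>bar \<sigma>\<close> into membership in \<open>?D\<close>.\<close>
  have I': "?I' = {i. i < length ?fs \<and> ?fs ! i \<in> ?D}"
  proof -
    have "bar \<rho> \<in> bar ` ?D \<longleftrightarrow> \<rho> \<in> ?D" if "\<rho> \<in> ?nb" for \<rho>
      using inj_on_image_mem_iff[OF inj_on_bar_nb that D_nb] .
    moreover have "?fs ! i \<in> ?nb" if "i < length ?fs" for i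
      using nth_mem[OF that] set_fs by simp
    ultimately show ?thesis
      unfolding row_ids_def star_rays_def rays_bar[OF assms(1)] length_map
      by (intro Collect_cong conj_cong refl) (simp only: nth_map)
  qed
  have fs_bij: "bij_betw ((!) ?fs) ?I' ?D"
    unfolding bij_betw_def
  proof
    show "inj_on ((!) ?fs) ?I'"
      unfolding I' using distinct_filter[OF distinct_rs]
      by (auto simp: inj_on_def nth_eq_iff_index_eq)
    show "(!) ?fs ` ?I' = ?D"
    proof
      show "?D \<subseteq> (!) ?fs ` ?I'"
      proof
        fix \<rho> assume "\<rho> \<in> ?D"
        then have "\<rho> \<in> set ?fs" using D_nb set_fs by blast
        then obtain i where "i < length ?fs" "?fs ! i = \<rho>" by (auto simp only: in_set_conv_nth)
        then show "\<rho> \<in> (!) ?fs ` ?I'" using \<open>\<rho> \<in> ?D\<close> I' by blast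
      qed
    qed (use I' in blast)
  qed
  have fin: "finite ?I'" by (simp add: I')
  have card_I': "card ?I' = d - k" using bij_betw_same_card[OF fs_bij] cardD by simp
  have g: "bij_betw ?g {..<d - k} ?D"
    using bij_betw_trans[OF pick_bij_betw[OF fin] fs_bij] card_I' by (simp add: o_def)
  have bij: "bij_betw ((!) rs) ?I (rays d \<sigma>)" by (rule rs_row_ids[OF rays_subset[OF \<sigma>(1)]])
  have card: "card ?I = d" using bij_betw_same_card[OF bij] card_rays \<sigma> assms by simp
  let ?f = "\<lambda>i. rs ! pick ?I i"
  \<comment> \<open>The size \<open>d\<close> is written as \<open>k + (d - k)\<close>, the shape
    required by \<open>abs_det_unit_rows\<close>.\<close>
  have f: "bij_betw ?f {..<k + (d - k)} (rays d \<sigma>)"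
    using bij_betw_trans[OF pick_bij_betw[OF row_ids_le(2)] bij] card k_le by (simp add: o_def)
  have pick_I: "pick ?I i < length rs" if "i < d" for i
    using pick_in_set_le[of i ?I] that card by (simp add: row_ids_def)
  have star: "submatrix (star_matrix d \<Sigma> rs U \<tau> T) ?I' UNIV =
      mat (d - k) (d - k) (\<lambda>(i, j). ?R (?g i) (k + j))" (is "?S = ?M")
  proof -
    have cols: "{j. j < d \<and> k \<le> j \<and> j < d} = {k..<d}" by auto
    have sm: "star_matrix d \<Sigma> rs U \<tau> T = mat (card ?N) (d - k) (\<lambda>(i, j). ?R (?fs ! i) (k + j))"
    proof (rule eq_matI)
      fix i j assume "i < dim_row (mat (card ?N) (d - k) (\<lambda>(i, j). ?R (?fs ! i) (k + j)))"
        "j < dim_col (mat (card ?N) (d - k) (\<lambda>(i, j). ?R (?fs ! i) (k + j)))"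
      then have ij: "i < card ?N" "j < d - k" by simp_all
      then have "star_matrix d \<Sigma> rs U \<tau> T $$ (i, j) = (U * T) $$ (pick ?N i, k + j)"
        using U_carrier N_eq
        by (simp add: star_matrix_def submatrix_def cols pick_atLeastLessThan)
      then show "star_matrix d \<Sigma> rs U \<tau> T $$ (i, j) =
          mat (card ?N) (d - k) (\<lambda>(i, j). ?R (?fs ! i) (k + j)) $$ (i, j)"
        using ij pick_N[of i] UT_index[of "pick ?N i" "k + j"] by (simp add: fs_nth)
    qed (use U_carrier N_eq in \<open>simp_all add: star_matrix_def dim_submatrix cols\<close>)
    have sub: "?I' \<subseteq> {..<card ?N}" using I' len_fs by auto
    have pick': "pick ?I' i < card ?N" if "i < d - k" for i
      using pick_in_set_le[of i ?I'] that card_I' sub by auto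
    have "?S = mat (d - k) (d - k) (\<lambda>(i, j). star_matrix d \<Sigma> rs U \<tau> T $$ (pick ?I' i, j))"
      using submatrix_UNIV_cols[of ?I' "star_matrix d \<Sigma> rs U \<tau> T"] sub card_I' by (simp add: sm)
    also have "\<dots> = ?M"
      by (rule eq_matI) (use pick' in \<open>simp_all add: sm\<close>)
    finally show ?thesis .
  qed
  have "submatrix (U * T) ?I UNIV = mat d d (\<lambda>(i, j). (U * T) $$ (pick ?I i, j))"
    using submatrix_UNIV_cols[of ?I "U * T"] row_ids_le(1) U_carrier card by auto
  also have "\<dots> = mat (k + (d - k)) (k + (d - k)) (\<lambda>(i, j). ?R (?f i) j)"
    by (rule eq_matI) (use k_le pick_I UT_index in auto)
  finally have UT: "submatrix (U * T) ?I UNIV = mat (k + (d - k)) (k + (d - k)) (\<lambda>(i, j). ?R (?f i) j)" .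
  have "\<bar>det (submatrix (U * T) ?I UNIV)\<bar> = \<bar>det ?M\<bar>"
    unfolding UT
    by (rule abs_det_unit_rows[OF f unit_ray_bij \<sigma>(2) g])
      (use k_le in \<open>auto simp: coords_unit_ray\<close>)
  then show ?thesis
    using det_submatrix_UT[OF \<sigma>(1) assms(2)] by (simp add: star abs_mult)
qed

section \<open>Both adjoints as sums over the star of \<tau>\<close>

text \<open>The maximal cones and the rays of the star fan are images under \<open>bar\<close>,
  which is injective on \<open>star\<close> and on the neighbours. So the sum and the products can
  be reindexed, and the renaming undoes \<open>bar\<close> on the variables.\<close>

lemma Adj_star_eq:
  "Adj_star d \<Sigma> rs U \<tau> T = (\<Sum>\<sigma>\<in>{\<sigma>\<in>star. lin_dim d \<sigma> = d}.
     pconst (complex_of_real (\<bar>det (submatrix U (row_ids rs (rays d \<sigma>)) UNIV)\<bar> * \<bar>det T\<bar>)) *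
     (\<Prod>\<rho>\<in>nb d \<Sigma> \<tau> - rays d \<sigma>. pvar \<rho>))"
proof -
  let ?A = "{\<sigma>\<in>star. lin_dim d \<sigma> = d}"
  let ?nb = "nb d \<Sigma> \<tau>"
  let ?c = "\<lambda>\<sigma>. complex_of_real (\<bar>det (submatrix U (row_ids rs (rays d \<sigma>)) UNIV)\<bar> * \<bar>det T\<bar>)"
  have fin_nb: "finite ?nb" using nb_subset finite_cones finite_subset by blast
  \<comment> \<open>No ray of \<tau> is a neighbour, so removing \<open>rays d \<sigma>\<close> or
    only its part outside \<tau> gives the same set.\<close>
  have diff: "bar ` ?nb - rays (d - k) (bar \<sigma>) = bar ` (?nb - rays d \<sigma>)" if "\<sigma> \<in> star" for \<sigma>
  proof -
    have "bar ` ?nb - rays (d - k) (bar \<sigma>) = bar ` (?nb - (rays d \<sigma> - rays d \<tau>))"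
      unfolding rays_bar[OF that]
      using inj_on_image_set_diff[OF inj_on_bar_nb _ rays_diff_nb[OF that], of ?nb] by auto
    moreover have "?nb - (rays d \<sigma> - rays d \<tau>) = ?nb - rays d \<sigma>"
      using nb_iff[OF tau_in_fan] by blast
    ultimately show ?thesis by simp
  qed
  have "Adj (d - k) (star_fan_coords d \<Sigma> \<tau> T) (star_rays d \<Sigma> rs \<tau> T) (star_matrix d \<Sigma> rs U \<tau> T) =
      (\<Sum>\<sigma>\<in>?A. pconst (?c \<sigma>) * (\<Prod>x\<in>bar ` (?nb - rays d \<sigma>). pvar x))"
    unfolding Adj_def cones_star_max cones_star_1
    by (subst sum.reindex[OF inj_on_subset[OF inj_on_bar_star]])
      (auto simp: diff abs_det_star intro!: sum.cong)
  then have "Adj_star d \<Sigma> rs U \<tau> T =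
      (\<Sum>\<sigma>\<in>?A. pconst (?c \<sigma>) * (\<Prod>x\<in>bar ` (?nb - rays d \<sigma>). pvar (inv_into ?nb bar x)))"
    unfolding Adj_star_def prename_def using fin_nb
    by (simp add: psubst_sum psubst_squarefree_monomial)
  also have "\<dots> = (\<Sum>\<sigma>\<in>?A. pconst (?c \<sigma>) * (\<Prod>\<rho>\<in>?nb - rays d \<sigma>. pvar \<rho>))"
  proof (intro sum.cong refl arg_cong2[where f = "(*)"])
    fix \<sigma>
    show "(\<Prod>x\<in>bar ` (?nb - rays d \<sigma>). pvar (inv_into ?nb bar x)) = (\<Prod>\<rho>\<in>?nb - rays d \<sigma>. pvar \<rho>)"
      by (subst prod.reindex[OF inj_on_subset[OF inj_on_bar_nb]])
        (auto simp: inv_into_f_f[OF inj_on_bar_nb])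
  qed
  finally show ?thesis .
qed

text \<open>If \<sigma> lacks a ray of \<tau>, the variable of that ray divides its monomial and the
  term vanishes. Otherwise no variable set to zero occurs in it.\<close>

lemma restrict_Adj:
  "restrict_Lambda d \<tau> (Adj d \<Sigma> rs U) = (\<Sum>\<sigma>\<in>{\<sigma>\<in>star. lin_dim d \<sigma> = d}.
     pconst (complex_of_real \<bar>det (submatrix U (row_ids rs (rays d \<sigma>)) UNIV)\<bar>) *
     (\<Prod>\<rho>\<in>cones d \<Sigma> 1 - rays d \<sigma>. pvar \<rho>))"
proof -
  let ?v = "\<lambda>\<rho>. if \<rho> \<in> rays d \<tau> then 0 else pvar \<rho> :: real vec set cpoly"
  let ?c = "\<lambda>\<sigma>. pconst (complex_of_real \<bar>det (submatrix U (row_ids rs (rays d \<sigma>)) UNIV)\<bar>)"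
  have "restrict_Lambda d \<tau> (Adj d \<Sigma> rs U) =
      (\<Sum>\<sigma>\<in>cones d \<Sigma> d. ?c \<sigma> * (\<Prod>\<rho>\<in>cones d \<Sigma> 1 - rays d \<sigma>. ?v \<rho>))"
    unfolding restrict_Lambda_def set_to_zero_def Adj_def using finite_cones
    by (simp add: psubst_sum psubst_squarefree_monomial)
  also have "\<dots> = (\<Sum>\<sigma>\<in>{\<sigma>\<in>star. lin_dim d \<sigma> = d}.
      ?c \<sigma> * (\<Prod>\<rho>\<in>cones d \<Sigma> 1 - rays d \<sigma>. pvar \<rho>))"
  proof (rule sum.mono_neutral_cong_right)
    show "finite (cones d \<Sigma> d)" by (rule finite_cones)
    show "{\<sigma>\<in>star. lin_dim d \<sigma> = d} \<subseteq> cones d \<Sigma> d" by (auto simp: star_def cones_def)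
    show "\<forall>\<sigma>\<in>cones d \<Sigma> d - {\<sigma>\<in>star. lin_dim d \<sigma> = d}.
        ?c \<sigma> * (\<Prod>\<rho>\<in>cones d \<Sigma> 1 - rays d \<sigma>. ?v \<rho>) = 0"
    proof
      fix \<sigma> assume "\<sigma> \<in> cones d \<Sigma> d - {\<sigma>\<in>star. lin_dim d \<sigma> = d}"
      then obtain \<rho> where "\<rho> \<in> rays d \<tau>" "\<rho> \<notin> rays d \<sigma>" by (auto simp: star_def cones_def)
      then have "\<exists>\<rho>\<in>cones d \<Sigma> 1 - rays d \<sigma>. ?v \<rho> = 0"
        using rays_subset[OF tau_in_fan] by auto
      then have "(\<Prod>\<rho>\<in>cones d \<Sigma> 1 - rays d \<sigma>. ?v \<rho>) = 0"
        using finite_cones by (intro prod_zero) auto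
      then show "?c \<sigma> * (\<Prod>\<rho>\<in>cones d \<Sigma> 1 - rays d \<sigma>. ?v \<rho>) = 0" by simp
    qed
    fix \<sigma> assume "\<sigma> \<in> {\<sigma>\<in>star. lin_dim d \<sigma> = d}"
    then show "?c \<sigma> * (\<Prod>\<rho>\<in>cones d \<Sigma> 1 - rays d \<sigma>. ?v \<rho>) =
        ?c \<sigma> * (\<Prod>\<rho>\<in>cones d \<Sigma> 1 - rays d \<sigma>. pvar \<rho>)"
      by (intro arg_cong2[where f = "(*)"] prod.cong refl) (auto simp: star_def)
  qed
  finally show ?thesis .
qed

text \<open>Term by term: the rays outside \<sigma> are the neighbours outside \<sigma> together
  with the rays outside both \<open>nb d \<Sigma> \<tau>\<close> and \<tau>(1), and the latter do
  not depend on \<sigma>.\<close>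

lemma restrict_Adj_eq_Adj_star:
  "restrict_Lambda d \<tau> (Adj d \<Sigma> rs U) =
    pconst (complex_of_real (inverse \<bar>det T\<bar>)) *
    (\<Prod>\<rho>\<in>cones d \<Sigma> 1 - nb d \<Sigma> \<tau> - rays d \<tau>. pvar \<rho>) * Adj_star d \<Sigma> rs U \<tau> T"
  unfolding restrict_Adj Adj_star_eq sum_distrib_left
proof (rule sum.cong[OF refl])
  fix \<sigma> assume "\<sigma> \<in> {\<sigma>\<in>star. lin_dim d \<sigma> = d}"
  then have \<sigma>: "\<sigma> \<in> star" by simp
  let ?E = "cones d \<Sigma> 1 - nb d \<Sigma> \<tau> - rays d \<tau>"
  let ?a = "\<bar>det (submatrix U (row_ids rs (rays d \<sigma>)) UNIV)\<bar>"
  have "rays d \<sigma> - rays d \<tau> \<subseteq> nb d \<Sigma> \<tau>" by (rule rays_diff_nb[OF \<sigma>])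
  moreover have "rays d \<tau> \<subseteq> rays d \<sigma>" using \<sigma> by (simp add: star_def)
  ultimately have split: "cones d \<Sigma> 1 - rays d \<sigma> = ?E \<union> (nb d \<Sigma> \<tau> - rays d \<sigma>)"
    using nb_subset by blast
  have monomial: "(\<Prod>\<rho>\<in>cones d \<Sigma> 1 - rays d \<sigma>. pvar \<rho>) =
      (\<Prod>\<rho>\<in>?E. pvar \<rho>) * (\<Prod>\<rho>\<in>nb d \<Sigma> \<tau> - rays d \<sigma>. pvar \<rho>)"
    unfolding split
    by (rule prod.union_disjoint) (use finite_cones nb_subset finite_subset in \<open>auto, blast\<close>)
  have coefficient: "pconst (complex_of_real ?a) =
      pconst (complex_of_real (inverse \<bar>det T\<bar>)) * pconst (complex_of_real (?a * \<bar>det T\<bar>))"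
  proof -
    have "?a = inverse \<bar>det T\<bar> * (?a * \<bar>det T\<bar>)" using det_T_nonzero by simp
    then show ?thesis by (metis pconst_mult of_real_mult)
  qed
  show "pconst (complex_of_real ?a) * (\<Prod>\<rho>\<in>cones d \<Sigma> 1 - rays d \<sigma>. pvar \<rho>) =
      pconst (complex_of_real (inverse \<bar>det T\<bar>)) * (\<Prod>\<rho>\<in>?E. pvar \<rho>) *
      (pconst (complex_of_real (?a * \<bar>det T\<bar>)) * (\<Prod>\<rho>\<in>nb d \<Sigma> \<tau> - rays d \<sigma>. pvar \<rho>))"
    unfolding monomial coefficient by (simp only: mult_ac)
qed

end

theorem lemma3p4:
  fixes d n k :: nat
    and \<Sigma> :: "real vec set set"
    and rs :: "real vec set list"
    and U T :: "real mat"
    and \<tau> :: "real vec set"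
  assumes "simplicial_fan d \<Sigma>"
    and "n = card (cones d \<Sigma> 1)"
    and "ray_matrix d \<Sigma> rs U"
    and "\<tau> \<in> cones d \<Sigma> k"
    and "adapted_matrix d rs U \<tau> T"
  shows "proj_lin_subspace n (int n - int k - 1) (Lambda d rs \<tau>) \<and>
    restrict_Lambda d \<tau> (Adj d \<Sigma> rs U) =
      pconst (complex_of_real (inverse \<bar>det T\<bar>)) *
      (\<Prod>\<rho>\<in>cones d \<Sigma> 1 - nb d \<Sigma> \<tau> - rays d \<tau>. pvar \<rho>) *
      Adj_star d \<Sigma> rs U \<tau> T"
proof -
  have \<tau>: "\<tau> \<in> \<Sigma>" "lin_dim d \<tau> = k" using assms(4) by (auto simp: cones_def)
  interpret star_of_cone d \<Sigma> rs U \<tau> T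
    by unfold_locales (use assms \<tau> in auto)
  \<comment> \<open>\<open>rs\<close> lists each ray of the fan exactly once.\<close>
  have "n = length rs"
    using assms(2) distinct_card[OF distinct_rs] set_rs by simp
  then show ?thesis
    using proj_lin_subspace_Lambda[OF \<tau>(1)] restrict_Adj_eq_Adj_star \<tau>(2) by simp
qed

end
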